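(* Consider the following polynomial vector fields on $\mathbb{R}^8$ with coordinates $(x_1,\dots,x_8)$: \begin{align*} X_1 &= \frac{\partial}{\partial x_1} - \frac{x_2}{2}\frac{\partial}{\partial x_3} - \frac{x_1^2+x_2^2}{2}\frac{\partial}{\partial x_5} - \frac{x_1x_2^2}{4}\frac{\partial}{\partial x_7} - \frac{x_2^3}{6}\frac{\partial}{\partial x_8},\\ X_2 &= \frac{\partial}{\partial x_2} + \frac{x_1}{2}\frac{\partial}{\partial x_3} + \frac{x_1^2+x_2^2}{2}\frac{\partial}{\partial x_4} + \frac{x_1^3}{6}\frac{\partial}{\partial x_6} + \frac{x_1^2x_2}{4}\frac{\partial}{\partial x_7},\\ X_3 &= \frac{\partial}{\partial x_3} + x_1\frac{\partial}{\partial x_4} + x_2\frac{\partial}{\partial x_5} + \frac{x_1^2}{2}\frac{\partial}{\partial x_6} + x_1x_2\frac{\partial}{\partial x_7} + \frac{x_2^2}{2}\frac{\partial}{\partial x_8},\\ X_4 &= \frac{\partial}{\partial x_4} + x_1\frac{\partial}{\partial x_6} + x_2\frac{\partial}{\partial x_7},\qquad X_5 = \frac{\partial}{\partial x_5} + x_1\frac{\partial}{\partial x_7} + x_2\frac{\partial}{\partial x_8},\\ X_6 &= \frac{\partial}{\partial x_6},\qquad X_7 = \frac{\partial}{\partial x_7},\qquad X_8 = \frac{\partial}{\partial x_8}. \end{align*} (1) These fields satisfy \begin{gather*} [X_1,X_2]=X_3,\qquad [X_1,X_3]=X_4,\qquad [X_2,X_3]=X_5,\\ [X_1,X_4]=X_6,\qquad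 [X_1,X_5]=[X_2,X_4]=X_7,\qquad [X_2,X_5]=X_8, \end{gather*} with all the other brackets $[X_i,X_j]$, $1\le i<j\le 8$, equal to zero. Thus $X_1,\dots,X_8$ model the Lie algebra $\mathcal{L}_2^{(4)}$. (2) The vector field $$X_0 = x_2\frac{\partial}{\partial x_1} - x_1\frac{\partial}{\partial x_2} + x_5\frac{\partial}{\partial x_4} - x_4\frac{\partial}{\partial x_5} + P\frac{\partial}{\partial x_6} + Q\frac{\partial}{\partial x_7} + R\frac{\partial}{\partial x_8},$$ where $$P = -\frac{x_1^4}{24}+\frac{x_1^2x_2^2}{8}+x_7,\qquad Q = \frac{x_1x_2^3}{12}+\frac{x_1^3x_2}{12}-2x_6+2x_8,\qquad R = \frac{x_1^2x_2^2}{8}-\frac{x_2^4}{24}-x_7,$$ satisfies \begin{gather*} [X_0,X_1]=X_2,\qquad [X_0,X_2]=-X_1,\qquad [X_0,X_3]=0,\\ [X_0,X_4]=X_5,\qquad [X_0,X_5]=-X_4,\\ [X_0,X_6]=2X_7,\qquad [X_0,X_7]=X_8-X_6,\qquad [X_0,X_8]=-2X_7. \end{gather*} Thus $X_0$ is an infinitesimal symmetry of the sub-Riemannian structure on $\mathbb{R}^8$ with orthonormal frame $\{X_1,X_2\}$.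
   Context: $\mathcal{L}_2^{(4)}$ denotes the real free nilpotent Lie algebra with 2 generators of step 4, i.e. the quotient of the free real Lie algebra on 2 generators by the ideal spanned by all commutators of degree $\geq 5$. It is 8-dimensional and has a basis $X_1,\dots,X_8$ whose only nonzero brackets (up to antisymmetry) are those listed in part (1). "Vector fields $X_1,\dots,X_8$ model the Lie algebra" means that their real linear span, with the commutator of vector fields, is a Lie algebra isomorphic to $\mathcal{L}_2^{(4)}$. The commutator of vector fields is $[X,Y]f = X(Yf)-Y(Xf)$. The sub-Riemannian structure with orthonormal frame $\{X_1,X_2\}$ consists of the distribution $\Delta_q=\mathrm{span}(X_1(q),X_2(q))$ and the inner product $g$ on $\Delta$ with $g(X_i,X_j)=\delta_{ij}$, $i,j\in\{1,2\}$. A vector field is an infinitesimal symmetry of this structure if its (local) flow preserves $\Delta$ and $g$. *)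

theory Defs
  imports "HOL-Analysis.Analysis" "HOL-Library.Function_Algebras"
begin

section \<open>Real Lie algebras\<close>

definition real_lie_algebra :: "'v::real_vector set \<Rightarrow> ('v \<Rightarrow> 'v \<Rightarrow> 'v) \<Rightarrow> bool" where
  "real_lie_algebra V br \<longleftrightarrow>
     subspace V \<and>
     (\<forall>x\<in>V. \<forall>y\<in>V. br x y \<in> V) \<and>
     (\<forall>x\<in>V. \<forall>y\<in>V. \<forall>z\<in>V. br (x + y) z = br x z + br y z \<and> br z (x + y) = br z x + br z y) \<and>
     (\<forall>c. \<forall>x\<in>V. \<forall>y\<in>V. br (c *\<^sub>R x) y = c *\<^sub>R br x y \<and> br x (c *\<^sub>R y) = c *\<^sub>R br x y) \<and>
     (\<forall>x\<in>V. br x x = 0) \<and>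
     (\<forall>x\<in>V. \<forall>y\<in>V. \<forall>z\<in>V. br x (br y z) + br y (br z x) + br z (br x y) = 0)"

definition lie_isomorphic ::
  "'v::real_vector set \<Rightarrow> ('v \<Rightarrow> 'v \<Rightarrow> 'v) \<Rightarrow> 'w::real_vector set \<Rightarrow> ('w \<Rightarrow> 'w \<Rightarrow> 'w) \<Rightarrow> bool" where
  "lie_isomorphic V br W br' \<longleftrightarrow>
     (\<exists>h. bij_betw h V W \<and>
          (\<forall>x\<in>V. \<forall>y\<in>V. h (x + y) = h x + h y) \<and>
          (\<forall>c. \<forall>x\<in>V. h (c *\<^sub>R x) = c *\<^sub>R h x) \<and>
          (\<forall>x\<in>V. \<forall>y\<in>V. h (br x y) = br' (h x) (h y)))"


section \<open>The free real Lie algebra\<close>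

text \<open>
  The free Lie algebra on a type of generators is the set of formal Lie expressions, modulo the
  least congruence that makes the axioms of a real Lie algebra true.
\<close>

datatype 'g lie_expr =
    Gen 'g
  | Zero
  | Add "'g lie_expr" "'g lie_expr"
  | Scale real "'g lie_expr"
  | Brk "'g lie_expr" "'g lie_expr"

inductive lie_eq :: "'g lie_expr \<Rightarrow> 'g lie_expr \<Rightarrow> bool" where
  refl: "lie_eq x x"
| sym: "lie_eq x y \<Longrightarrow> lie_eq y x"
| trans: "lie_eq x y \<Longrightarrow> lie_eq y z \<Longrightarrow> lie_eq x z"
| cong_add: "lie_eq x x' \<Longrightarrow> lie_eq y y' \<Longrightarrow> lie_eq (Add x y) (Add x' y')"
| cong_scale: "lie_eq x x' \<Longrightarrow> lie_eq (Scale c x) (Scale c x')"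
| cong_brk: "lie_eq x x' \<Longrightarrow> lie_eq y y' \<Longrightarrow> lie_eq (Brk x y) (Brk x' y')"
| add_assoc: "lie_eq (Add (Add x y) z) (Add x (Add y z))"
| add_comm: "lie_eq (Add x y) (Add y x)"
| add_zero: "lie_eq (Add Zero x) x"
| add_inv: "lie_eq (Add (Scale (-1) x) x) Zero"
| scale_add: "lie_eq (Scale c (Add x y)) (Add (Scale c x) (Scale c y))"
| add_scale: "lie_eq (Scale (c + d) x) (Add (Scale c x) (Scale d x))"
| scale_scale: "lie_eq (Scale c (Scale d x)) (Scale (c * d) x)"
| scale_one: "lie_eq (Scale 1 x) x"
| brk_add_left: "lie_eq (Brk (Add x y) z) (Add (Brk x z) (Brk y z))"
| brk_add_right: "lie_eq (Brk z (Add x y)) (Add (Brk z x) (Brk z y))"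
| brk_scale_left: "lie_eq (Brk (Scale c x) y) (Scale c (Brk x y))"
| brk_scale_right: "lie_eq (Brk x (Scale c y)) (Scale c (Brk x y))"
| brk_self: "lie_eq (Brk x x) Zero"
| jacobi: "lie_eq (Add (Brk x (Brk y z)) (Add (Brk y (Brk z x)) (Brk z (Brk x y)))) Zero"

quotient_type 'g free_lie = "'g lie_expr" / lie_eq
  by (intro equivpI reflpI sympI transpI) (auto intro: lie_eq.refl lie_eq.sym lie_eq.trans)

instantiation free_lie :: (type) real_vector
begin

lift_definition zero_free_lie :: "'a free_lie" is Zero .

lift_definition plus_free_lie :: "'a free_lie \<Rightarrow> 'a free_lie \<Rightarrow> 'a free_lie" is Add
  by (rule lie_eq.cong_add)

lift_definition scaleR_free_lie :: "real \<Rightarrow> 'a free_lie \<Rightarrow> 'a free_lie" is Scale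
  by (rule lie_eq.cong_scale)

lift_definition uminus_free_lie :: "'a free_lie \<Rightarrow> 'a free_lie" is "Scale (-1)"
  by (rule lie_eq.cong_scale)

lift_definition minus_free_lie :: "'a free_lie \<Rightarrow> 'a free_lie \<Rightarrow> 'a free_lie" is
  "\<lambda>x y. Add x (Scale (-1) y)"
  by (intro lie_eq.cong_add lie_eq.cong_scale)

instance
proof
  fix x y z :: "'a free_lie" and c d :: real
  show "x + y + z = x + (y + z)" by transfer (rule lie_eq.add_assoc)
  show "x + y = y + x" by transfer (rule lie_eq.add_comm)
  show "0 + x = x" by transfer (rule lie_eq.add_zero)
  show "- x + x = 0" by transfer (rule lie_eq.add_inv)
  show "x - y = x + - y" by transfer (rule lie_eq.refl)
  show "c *\<^sub>R (x + y) = c *\<^sub>R x + c *\<^sub>R y" by transfer (rule lie_eq.scale_add)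
  show "(c + d) *\<^sub>R x = c *\<^sub>R x + d *\<^sub>R x" by transfer (rule lie_eq.add_scale)
  show "c *\<^sub>R d *\<^sub>R x = (c * d) *\<^sub>R x" by transfer (rule lie_eq.scale_scale)
  show "1 *\<^sub>R x = x" by transfer (rule lie_eq.scale_one)
qed

end

lift_definition free_gen :: "'g \<Rightarrow> 'g free_lie" is Gen .

lift_definition free_bracket :: "'g free_lie \<Rightarrow> 'g free_lie \<Rightarrow> 'g free_lie" is Brk
  by (rule lie_eq.cong_brk)

lemma free_bracket_add_left: "free_bracket (x + y) z = free_bracket x z + free_bracket y z"
  by transfer (rule lie_eq.brk_add_left)

lemma free_bracket_add_right: "free_bracket z (x + y) = free_bracket z x + free_bracket z y"
  by transfer (rule lie_eq.brk_add_right)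

lemma free_bracket_scale_left: "free_bracket (c *\<^sub>R x) y = c *\<^sub>R free_bracket x y"
  by transfer (rule lie_eq.brk_scale_left)

lemma free_bracket_scale_right: "free_bracket x (c *\<^sub>R y) = c *\<^sub>R free_bracket x y"
  by transfer (rule lie_eq.brk_scale_right)

lemma free_bracket_self: "free_bracket x x = 0"
  by transfer (rule lie_eq.brk_self)

lemma free_bracket_jacobi:
  "free_bracket x (free_bracket y z) + free_bracket y (free_bracket z x)
     + free_bracket z (free_bracket x y) = 0"
  unfolding add.assoc by transfer (rule lie_eq.jacobi)

lemma free_bracket_zero_left: "free_bracket 0 y = 0"
  using free_bracket_scale_left[of 0 0 y] by simp

lemma free_bracket_zero_right: "free_bracket x 0 = 0"
  using free_bracket_scale_right[of x 0 0] by simp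

lemma real_lie_algebra_free: "real_lie_algebra (UNIV :: 'g free_lie set) free_bracket"
  by (simp add: real_lie_algebra_def free_bracket_add_left free_bracket_add_right
      free_bracket_scale_left free_bracket_scale_right free_bracket_self free_bracket_jacobi)


section \<open>The free nilpotent Lie algebra\<close>

inductive commutator :: "nat \<Rightarrow> 'g free_lie \<Rightarrow> bool" where
  gen: "commutator 1 (free_gen a)"
| bracket: "commutator m x \<Longrightarrow> commutator n y \<Longrightarrow> commutator (m + n) (free_bracket x y)"

text \<open>The step is passed as the cardinality of a type, so that the quotient can be a type.\<close>

definition high_commutators :: "'s itself \<Rightarrow> 'g free_lie set" where
  "high_commutators _ = span {x. \<exists>n > CARD('s). commutator n x}"

lemma subspace_high_commutators: "subspace (high_commutators s)"
  by (simp add: high_commutators_def)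

lemma span_commutators: "span {x. \<exists>n. commutator n x} = (UNIV :: 'g free_lie set)"
proof -
  let ?C = "{x :: 'g free_lie. \<exists>n. commutator n x}"
  have brk: "free_bracket x y \<in> span ?C" if "x \<in> span ?C" "y \<in> span ?C" for x y
    using that(1)
  proof (induction rule: span_induct_alt)
    case base
    show ?case by (simp add: free_bracket_zero_left span_zero)
  next
    case (step c a x)
    have "free_bracket a y \<in> span ?C"
      using that(2)
    proof (induction rule: span_induct_alt)
      case base
      show ?case by (simp add: free_bracket_zero_right span_zero)
    next
      case (step d b y)
      have "free_bracket a b \<in> ?C"
        using step \<open>a \<in> ?C\<close> commutator.bracket by blast
      then show ?case
        using step by (simp add: free_bracket_add_right free_bracket_scale_right
            span_add span_scale span_base)
    qed
    then show ?case
      using step by (simp add: free_bracket_add_left free_bracket_scale_left span_add span_scale)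
  qed
  have "abs_free_lie e \<in> span ?C" for e
  proof (induction e)
    case (Gen a)
    have "free_gen a \<in> ?C" by (intro CollectI exI) (rule commutator.gen)
    then show ?case by (simp add: free_gen.abs_eq span_base)
  next
    case Zero
    then show ?case by (metis span_zero zero_free_lie.abs_eq)
  next
    case (Add e1 e2)
    then show ?case by (metis plus_free_lie.abs_eq span_add)
  next
    case (Scale c e)
    then show ?case by (metis scaleR_free_lie.abs_eq span_scale)
  next
    case (Brk e1 e2)
    then show ?case by (metis brk free_bracket.abs_eq)
  qed
  then have "x \<in> span ?C" for x
    by (induction x rule: free_lie.abs_induct)
  then show ?thesis
    by blast
qed

lemma ideal_high_commutators:
  fixes x y :: "'g free_lie"
  assumes "x \<in> high_commutators TYPE('s)"
  shows "free_bracket x y \<in> high_commutators TYPE('s)"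
    and "free_bracket y x \<in> high_commutators TYPE('s)"
proof -
  let ?H = "{x :: 'g free_lie. \<exists>n > CARD('s). commutator n x}"
  let ?C = "{x :: 'g free_lie. \<exists>n. commutator n x}"
  have y: "y \<in> span ?C" by (simp add: span_commutators)
  have *: "free_bracket x y \<in> span ?H \<and> free_bracket y x \<in> span ?H"
    using assms unfolding high_commutators_def
  proof (induction rule: span_induct_alt)
    case base
    show ?case by (simp add: free_bracket_zero_left free_bracket_zero_right span_zero)
  next
    case (step c a x)
    have "free_bracket a y \<in> span ?H \<and> free_bracket y a \<in> span ?H"
      using y
    proof (induction rule: span_induct_alt)
      case base
      show ?case by (simp add: free_bracket_zero_left free_bracket_zero_right span_zero)
    next
      case (step d b y)
      obtain m n where mn: "commutator m b" "commutator n a" "n > CARD('s)"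
        using step \<open>a \<in> ?H\<close> by blast
      have "free_bracket a b \<in> ?H"
        using commutator.bracket[OF mn(2,1)] mn(3) trans_less_add1 by blast
      moreover have "free_bracket b a \<in> ?H"
        using commutator.bracket[OF mn(1,2)] mn(3) trans_less_add2 by blast
      ultimately show ?case
        using step by (simp add: free_bracket_add_left free_bracket_add_right
            free_bracket_scale_left free_bracket_scale_right span_add span_scale span_base)
    qed
    then show ?case
      using step by (simp add: free_bracket_add_left free_bracket_add_right
          free_bracket_scale_left free_bracket_scale_right span_add span_scale)
  qed
  show "free_bracket x y \<in> high_commutators TYPE('s)"
    and "free_bracket y x \<in> high_commutators TYPE('s)"
    using * by (auto simp: high_commutators_def)
qed

quotient_type ('g, 's) free_nilpotent =
  "'g free_lie" / "\<lambda>x y. x - y \<in> high_commutators TYPE('s)"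
proof (intro equivpI reflpI sympI transpI)
  fix x y z :: "'g free_lie"
  have S: "subspace (high_commutators TYPE('s) :: 'g free_lie set)"
    by (rule subspace_high_commutators)
  show "x - x \<in> high_commutators TYPE('s)" using subspace_0[OF S] by simp
  show "y - x \<in> high_commutators TYPE('s)" if "x - y \<in> high_commutators TYPE('s)"
    using subspace_neg[OF S that] by simp
  show "x - z \<in> high_commutators TYPE('s)"
    if "x - y \<in> high_commutators TYPE('s)" "y - z \<in> high_commutators TYPE('s)"
    using subspace_add[OF S that] by simp
qed

instantiation free_nilpotent :: (type, type) real_vector
begin

lift_definition zero_free_nilpotent :: "('a, 'b) free_nilpotent" is 0 .

lift_definition plus_free_nilpotent ::
  "('a, 'b) free_nilpotent \<Rightarrow> ('a, 'b) free_nilpotent \<Rightarrow> ('a, 'b) free_nilpotent" is "(+)"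
proof -
  fix x x' y y' :: "'a free_lie"
  assume "x - x' \<in> high_commutators TYPE('b)" "y - y' \<in> high_commutators TYPE('b)"
  from subspace_add[OF subspace_high_commutators this]
  show "x + y - (x' + y') \<in> high_commutators TYPE('b)" by (simp only: add_diff_add)
qed

lift_definition scaleR_free_nilpotent ::
  "real \<Rightarrow> ('a, 'b) free_nilpotent \<Rightarrow> ('a, 'b) free_nilpotent" is scaleR
proof -
  fix c and x x' :: "'a free_lie"
  assume "x - x' \<in> high_commutators TYPE('b)"
  from subspace_scale[OF subspace_high_commutators this]
  show "c *\<^sub>R x - c *\<^sub>R x' \<in> high_commutators TYPE('b)"
    by (simp only: scaleR_right_diff_distrib)
qed

definition uminus_free_nilpotent :: "('a, 'b) free_nilpotent \<Rightarrow> ('a, 'b) free_nilpotent" where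
  "uminus_free_nilpotent x = (-1) *\<^sub>R x"

definition minus_free_nilpotent ::
  "('a, 'b) free_nilpotent \<Rightarrow> ('a, 'b) free_nilpotent \<Rightarrow> ('a, 'b) free_nilpotent" where
  "minus_free_nilpotent x y = x + (-1) *\<^sub>R y"

instance
proof
  fix x y z :: "('a, 'b) free_nilpotent" and c d :: real
  note [simp] = subspace_0[OF subspace_high_commutators]
  show "x + y + z = x + (y + z)" by transfer (simp add: add.assoc)
  show "x + y = y + x" by transfer (simp add: add.commute)
  show "0 + x = x" by transfer simp
  show "- x + x = 0" unfolding uminus_free_nilpotent_def by transfer simp
  show "x - y = x + - y" by (simp only: minus_free_nilpotent_def uminus_free_nilpotent_def)
  show "c *\<^sub>R (x + y) = c *\<^sub>R x + c *\<^sub>R y" by transfer (simp add: scaleR_add_right)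
  show "(c + d) *\<^sub>R x = c *\<^sub>R x + d *\<^sub>R x" by transfer (simp add: scaleR_add_left)
  show "c *\<^sub>R d *\<^sub>R x = (c * d) *\<^sub>R x" by transfer simp
  show "1 *\<^sub>R x = x" by transfer simp
qed

end

lift_definition nilpotent_bracket ::
  "('g, 's) free_nilpotent \<Rightarrow> ('g, 's) free_nilpotent \<Rightarrow> ('g, 's) free_nilpotent"
  is free_bracket
proof -
  fix x x' y y' :: "'g free_lie"
  assume "x - x' \<in> high_commutators TYPE('s)" "y - y' \<in> high_commutators TYPE('s)"
  then have "free_bracket (x - x') y + free_bracket x' (y - y') \<in> high_commutators TYPE('s)"
    by (intro subspace_add[OF subspace_high_commutators] ideal_high_commutators)
  moreover have "free_bracket x y = free_bracket (x - x') y + free_bracket x' y"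
    "free_bracket x' y = free_bracket x' (y - y') + free_bracket x' y'"
    by (simp_all flip: free_bracket_add_left free_bracket_add_right)
  ultimately show "free_bracket x y - free_bracket x' y' \<in> high_commutators TYPE('s)"
    by (simp add: algebra_simps)
qed

lemma abs_free_nilpotent_simps:
  "abs_free_nilpotent x + abs_free_nilpotent y = abs_free_nilpotent (x + y)"
  "c *\<^sub>R abs_free_nilpotent x = abs_free_nilpotent (c *\<^sub>R x)"
  "nilpotent_bracket (abs_free_nilpotent x) (abs_free_nilpotent y)
     = abs_free_nilpotent (free_bracket x y)"
  "0 = abs_free_nilpotent 0"
  by (simp_all add: plus_free_nilpotent.abs_eq scaleR_free_nilpotent.abs_eq
      nilpotent_bracket.abs_eq zero_free_nilpotent_def)

lemma real_lie_algebra_free_nilpotent: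
  "real_lie_algebra (UNIV :: ('g, 's) free_nilpotent set) nilpotent_bracket"
proof -
  let ?b = "nilpotent_bracket :: ('g, 's) free_nilpotent \<Rightarrow> _"
  have "?b (x + y) z = ?b x z + ?b y z" "?b z (x + y) = ?b z x + ?b z y"
    "?b (c *\<^sub>R x) y = c *\<^sub>R ?b x y" "?b x (c *\<^sub>R y) = c *\<^sub>R ?b x y"
    "?b x x = 0" "?b x (?b y z) + ?b y (?b z x) + ?b z (?b x y) = 0" for x y z c
  proof -
    have *: "\<exists>u'. u = abs_free_nilpotent u'" for u :: "('g, 's) free_nilpotent"
      by (induction u rule: free_nilpotent.abs_induct) blast
    obtain x' y' z' where "x = abs_free_nilpotent x'" "y = abs_free_nilpotent y'"
      "z = abs_free_nilpotent z'"
      using *[of x] *[of y] *[of z] by blast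
    then show "?b (x + y) z = ?b x z + ?b y z" "?b z (x + y) = ?b z x + ?b z y"
      "?b (c *\<^sub>R x) y = c *\<^sub>R ?b x y" "?b x (c *\<^sub>R y) = c *\<^sub>R ?b x y"
      "?b x x = 0" "?b x (?b y z) + ?b y (?b z x) + ?b z (?b x y) = 0"
      by (simp_all only: abs_free_nilpotent_simps free_bracket_add_left free_bracket_add_right
          free_bracket_scale_left free_bracket_scale_right free_bracket_self free_bracket_jacobi)
  qed
  then show ?thesis
    by (simp add: real_lie_algebra_def)
qed


section \<open>Vector fields\<close>

instantiation "fun" :: (type, real_vector) real_vector
begin

definition scaleR_fun :: "real \<Rightarrow> ('a \<Rightarrow> 'b) \<Rightarrow> 'a \<Rightarrow> 'b" where
  "scaleR_fun c f = (\<lambda>x. c *\<^sub>R f x)"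

instance
  by standard (simp_all add: scaleR_fun_def plus_fun_def algebra_simps)

end

type_synonym 'n vfield = "real^'n \<Rightarrow> real^'n"

primrec ck :: "nat \<Rightarrow> (real^'n::finite \<Rightarrow> real) \<Rightarrow> bool" where
  "ck 0 f \<longleftrightarrow> continuous_on UNIV f"
| "ck (Suc k) f \<longleftrightarrow>
     (\<forall>x. f differentiable (at x)) \<and> (\<forall>v. ck k (\<lambda>x. frechet_derivative f (at x) v))"

definition smooth :: "(real^'n::finite \<Rightarrow> real) \<Rightarrow> bool" where
  "smooth f \<longleftrightarrow> (\<forall>k. ck k f)"

definition smooth_vfield :: "'n::finite vfield \<Rightarrow> bool" where
  "smooth_vfield X \<longleftrightarrow> (\<forall>i. smooth (\<lambda>x. X x $ i))"

definition vfield_apply :: "'n::finite vfield \<Rightarrow> (real^'n \<Rightarrow> real) \<Rightarrow> real^'n \<Rightarrow> real" where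
  "vfield_apply X f = (\<lambda>x. frechet_derivative f (at x) (X x))"

text \<open>
  For smooth \<^term>\<open>X\<close> and \<^term>\<open>Y\<close> there is exactly one such \<^term>\<open>Z\<close>; uniqueness is seen on
  the coordinate functions. The value is meaningful only if such a \<^term>\<open>Z\<close> exists.
\<close>

definition lie_bracket :: "'n::finite vfield \<Rightarrow> 'n vfield \<Rightarrow> 'n vfield" where
  "lie_bracket X Y =
     (THE Z. \<forall>f. smooth f \<longrightarrow>
        vfield_apply Z f = vfield_apply X (vfield_apply Y f) - vfield_apply Y (vfield_apply X f))"


section \<open>Sub-Riemannian structures and infinitesimal symmetries\<close>

definition inner_product_on :: "'v::real_vector set \<Rightarrow> ('v \<Rightarrow> 'v \<Rightarrow> real) \<Rightarrow> bool" where
  "inner_product_on V b \<longleftrightarrow>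
     (\<forall>u\<in>V. \<forall>v\<in>V. b u v = b v u) \<and>
     (\<forall>u\<in>V. \<forall>v\<in>V. \<forall>w\<in>V. b (u + v) w = b u w + b v w) \<and>
     (\<forall>c. \<forall>u\<in>V. \<forall>v\<in>V. b (c *\<^sub>R u) v = c * b u v) \<and>
     (\<forall>u\<in>V. u \<noteq> 0 \<longrightarrow> 0 < b u u)"

text \<open>
  The sub-Riemannian structure \<^term>\<open>(\<Delta>, g)\<close> has the vector fields \<^term>\<open>X i\<close>, for
  \<^term>\<open>i \<in> I\<close>, as an orthonormal frame. This determines \<^term>\<open>\<Delta>\<close>, and it determines
  \<^term>\<open>g q\<close> on \<^term>\<open>\<Delta> q\<close>; outside \<^term>\<open>\<Delta> q\<close> the values of \<^term>\<open>g q\<close> are irrelevant.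
\<close>

definition orthonormal_frame ::
  "'i set \<Rightarrow> ('i \<Rightarrow> 'n::finite vfield) \<Rightarrow> (real^'n \<Rightarrow> (real^'n) set) \<Rightarrow>
   (real^'n \<Rightarrow> real^'n \<Rightarrow> real^'n \<Rightarrow> real) \<Rightarrow> bool" where
  "orthonormal_frame I X \<Delta> g \<longleftrightarrow>
     (\<forall>i\<in>I. smooth_vfield (X i)) \<and>
     (\<forall>q. \<Delta> q = span {X i q |i. i \<in> I} \<and>
          inner_product_on (\<Delta> q) (g q) \<and>
          (\<forall>i\<in>I. \<forall>j\<in>I. g q (X i q) (X j q) = (if i = j then 1 else 0)))"

definition local_flow ::
  "'n::finite vfield \<Rightarrow> (real \<times> (real^'n)) set \<Rightarrow> (real \<Rightarrow> real^'n \<Rightarrow> real^'n) \<Rightarrow> bool" where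
  "local_flow X D \<phi> \<longleftrightarrow>
     open D \<and>
     (\<forall>q. (0, q) \<in> D \<and> \<phi> 0 q = q \<and> is_interval {t. (t, q) \<in> D} \<and>
          (\<forall>t. (t, q) \<in> D \<longrightarrow> ((\<lambda>s. \<phi> s q) has_vector_derivative X (\<phi> t q)) (at t)))"

text \<open>
  A smooth vector field has a local flow, any two agree on the intersection of their domains, and
  the maps \<^term>\<open>\<phi> t\<close> are smooth, so quantifying over all local flows, with the differential of
  \<^term>\<open>\<phi> t\<close> asserted to exist, neither adds nor loses anything.
\<close>

definition infinitesimal_symmetry ::
  "'n::finite vfield \<Rightarrow> (real^'n \<Rightarrow> (real^'n) set) \<Rightarrow>
   (real^'n \<Rightarrow> real^'n \<Rightarrow> real^'n \<Rightarrow> real) \<Rightarrow> bool" where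
  "infinitesimal_symmetry X \<Delta> g \<longleftrightarrow>
     smooth_vfield X \<and>
     (\<forall>D \<phi>. local_flow X D \<phi> \<longrightarrow>
        (\<forall>(t, q) \<in> D. \<exists>L. (\<phi> t has_derivative L) (at q) \<and>
           L ` \<Delta> q = \<Delta> (\<phi> t q) \<and>
           (\<forall>u\<in>\<Delta> q. \<forall>v\<in>\<Delta> q. g (\<phi> t q) (L u) (L v) = g q u v)))"


section \<open>The vector fields\<close>

text \<open>The field \<open>\<partial>/\<partial>x\<^sub>i\<close>; the index \<^term>\<open>8 :: 8\<close> is the same as \<^term>\<open>0 :: 8\<close>.\<close>

abbreviation pd :: "8 \<Rightarrow> real^8" where
  "pd i \<equiv> axis i 1"

definition X1 :: "8 vfield" where
  "X1 x = pd 1 - (x$2 / 2) *\<^sub>R pd 3 - (((x$1)^2 + (x$2)^2) / 2) *\<^sub>R pd 5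
     - (x$1 * (x$2)^2 / 4) *\<^sub>R pd 7 - ((x$2)^3 / 6) *\<^sub>R pd 8"

definition X2 :: "8 vfield" where
  "X2 x = pd 2 + (x$1 / 2) *\<^sub>R pd 3 + (((x$1)^2 + (x$2)^2) / 2) *\<^sub>R pd 4
     + ((x$1)^3 / 6) *\<^sub>R pd 6 + ((x$1)^2 * x$2 / 4) *\<^sub>R pd 7"

definition X3 :: "8 vfield" where
  "X3 x = pd 3 + (x$1) *\<^sub>R pd 4 + (x$2) *\<^sub>R pd 5 + ((x$1)^2 / 2) *\<^sub>R pd 6
     + (x$1 * x$2) *\<^sub>R pd 7 + ((x$2)^2 / 2) *\<^sub>R pd 8"

definition X4 :: "8 vfield" where
  "X4 x = pd 4 + (x$1) *\<^sub>R pd 6 + (x$2) *\<^sub>R pd 7"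

definition X5 :: "8 vfield" where
  "X5 x = pd 5 + (x$1) *\<^sub>R pd 7 + (x$2) *\<^sub>R pd 8"

definition X6 :: "8 vfield" where
  "X6 x = pd 6"

definition X7 :: "8 vfield" where
  "X7 x = pd 7"

definition X8 :: "8 vfield" where
  "X8 x = pd 8"

definition P :: "real^8 \<Rightarrow> real" where
  "P x = - ((x$1)^4 / 24) + (x$1)^2 * (x$2)^2 / 8 + x$7"

definition Q :: "real^8 \<Rightarrow> real" where
  "Q x = x$1 * (x$2)^3 / 12 + (x$1)^3 * x$2 / 12 - 2 * x$6 + 2 * x$8"

definition R :: "real^8 \<Rightarrow> real" where
  "R x = (x$1)^2 * (x$2)^2 / 8 - (x$2)^4 / 24 - x$7"

definition X0 :: "8 vfield" where
  "X0 x = (x$2) *\<^sub>R pd 1 - (x$1) *\<^sub>R pd 2 + (x$5) *\<^sub>R pd 4 - (x$4) *\<^sub>R pd 5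
     + P x *\<^sub>R pd 6 + Q x *\<^sub>R pd 7 + R x *\<^sub>R pd 8"

definition X :: "nat \<Rightarrow> 8 vfield" where
  "X i = [X0, X1, X2, X3, X4, X5, X6, X7, X8] ! i"

end

theory Submission
  imports Defs
begin

text \<open>
  Everything is reduced to computations with coefficient vectors in \<open>\<real>\<^sup>8\<close>. The two fields in a
  bracket are written in coordinates; by the symmetry of second derivatives
  (\<open>mixed_second_derivatives_commute\<close>) the commutator of the two derivations is the derivation along
  \<open>DW V - DV W\<close> (\<open>lie_bracket_eqI\<close>). For a combination \<open>frame a\<close> of \<open>X\<^sub>1, \<dots>, X\<^sub>8\<close> with
  constant coefficients \<open>a\<close> this gives \<open>[frame a, frame b] = frame (coord_bracket a b)\<close>, where
  \<open>coord_bracket\<close> encodes the structure constants, and \<open>[X\<^sub>0, frame a] = frame (rot_gen a)\<close>. All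
  bracket relations are instances. Since \<open>frame a 0 = a\<close>, evaluation at the origin identifies the
  span of the fields with \<open>\<real>\<^sup>8\<close>.

  The same vectors describe the free nilpotent algebra: send \<open>a\<close> to the combination of the
  classes of the eight commutators \<open>E\<^sub>1, \<dots>, E\<^sub>8\<close> that mirror the relations in part (1). This map
  preserves brackets, because brackets of total degree above 4 vanish and
  \<open>[E\<^sub>2, E\<^sub>4] = [E\<^sub>1, E\<^sub>5]\<close> by the Jacobi identity; it is onto, because its image is a subalgebra
  that contains the generators. It is one-to-one, because the universal property of the free algebra
  yields a homomorphism back to \<open>(\<real>\<^sup>8, coord_bracket)\<close>, which respects degrees and so kills all
  commutators of degree above 4 (\<open>bij_hall_class\<close>).

  For the symmetry, a polynomial change of coordinates (\<open>chart\<close>) turns \<open>X\<^sub>0\<close> into a linear field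
  whose flow \<open>rot\<close> is known in closed form. Any local flow of \<open>X\<^sub>0\<close> must agree with the
  transported linear flow (\<open>local_flow_X0_eq_flow\<close>), because rotating back along a trajectory gives
  a constant. The differential of this flow maps the frame \<open>X\<^sub>1, X\<^sub>2\<close> to itself, rotated by the
  angle \<open>- t\<close> (\<open>flow_pushes_frame\<close>), and a rotation of an orthonormal frame preserves its span and
  the inner product.
\<close>

section \<open>Symmetry of second derivatives\<close>

text \<open>
  The second difference of \<open>f\<close> over the parallelogram with sides \<open>h u\<close> and \<open>h v\<close> does not depend on the
  order in which the two differences are taken. Applying the mean value theorem twice, in either
  order, expresses it by the one or the other second derivative at a point near \<open>x\<close>, and continuity
  lets these points tend to \<open>x\<close>.
\<close>
lemma mixed_second_derivatives_commute:
  fixes f :: "'a::real_normed_vector \<Rightarrow> real"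
  assumes f: "\<And>y. (f has_derivative f' y) (at y)"
    and fu: "\<And>y. ((\<lambda>y. f' y u) has_derivative fu' y) (at y)"
    and fv: "\<And>y. ((\<lambda>y. f' y v) has_derivative fv' y) (at y)"
    and cu: "isCont (\<lambda>y. fu' y v) x"
    and cv: "isCont (\<lambda>y. fv' y u) x"
  shows "fu' x v = fv' x u"
proof (rule ccontr)
  have line: "((\<lambda>s. g (p + s *\<^sub>R w)) has_real_derivative g' (p + s *\<^sub>R w) w) (at s)"
    if "\<And>y. (g has_derivative g' y) (at y)" for g :: "'a \<Rightarrow> real" and g' p w s
  proof -
    have "((\<lambda>s. g (p + s *\<^sub>R w)) has_derivative (\<lambda>h. g' (p + s *\<^sub>R w) (h *\<^sub>R w))) (at s)"
      by (rule has_derivative_compose[OF _ that]) (auto intro!: derivative_eq_intros)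
    moreover have "linear (g' (p + s *\<^sub>R w))"
      using that has_derivative_linear by blast
    ultimately show ?thesis
      by (simp add: has_field_derivative_def linear_scale mult_commute_abs)
  qed
  have square: "\<exists>s t. 0 < s \<and> s < h \<and> 0 < t \<and> t < h \<and>
      f (x + h *\<^sub>R a + h *\<^sub>R b) - f (x + h *\<^sub>R b) - (f (x + h *\<^sub>R a) - f x)
        = h * (h * fa' (x + s *\<^sub>R a + t *\<^sub>R b) b)"
    if "0 < h" and fa: "\<And>y. ((\<lambda>y. f' y a) has_derivative fa' y) (at y)" for h a b fa'
  proof -
    have "((\<lambda>s. f (x + h *\<^sub>R b + s *\<^sub>R a) - f (x + s *\<^sub>R a)) has_real_derivative
        f' (x + h *\<^sub>R b + s *\<^sub>R a) a - f' (x + s *\<^sub>R a) a) (at s)" for s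
      by (intro DERIV_diff line f)
    from MVT2[OF \<open>0 < h\<close> this] obtain s where s: "0 < s" "s < h" and
      1: "f (x + h *\<^sub>R b + h *\<^sub>R a) - f (x + h *\<^sub>R a) - (f (x + h *\<^sub>R b) - f x)
         = h * (f' (x + h *\<^sub>R b + s *\<^sub>R a) a - f' (x + s *\<^sub>R a) a)"
      by auto
    from MVT2[OF \<open>0 < h\<close> line[OF fa, of "x + s *\<^sub>R a" b]] obtain t where t: "0 < t" "t < h" and
      2: "f' (x + s *\<^sub>R a + h *\<^sub>R b) a - f' (x + s *\<^sub>R a) a = h * fa' (x + s *\<^sub>R a + t *\<^sub>R b) b"
      by auto
    show ?thesis
      using s t 1 2 by (intro exI[of _ s] exI[of _ t]) (simp add: algebra_simps)
  qed
  assume ne: "fu' x v \<noteq> fv' x u"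
  define e where "e = dist (fu' x v) (fv' x u) / 2"
  have "e > 0" using ne by (simp add: e_def)
  obtain d1 where d1: "d1 > 0" "\<And>y. dist y x < d1 \<Longrightarrow> dist (fu' y v) (fu' x v) < e"
    using cu \<open>e > 0\<close> unfolding continuous_at_eps_delta by blast
  obtain d2 where d2: "d2 > 0" "\<And>y. dist y x < d2 \<Longrightarrow> dist (fv' y u) (fv' x u) < e"
    using cv \<open>e > 0\<close> unfolding continuous_at_eps_delta by blast
  define h where "h = min d1 d2 / (norm u + norm v + 1)"
  have pos: "norm u + norm v + 1 > 0"
    by (meson add_nonneg_pos add_nonneg_nonneg norm_ge_zero zero_less_one)
  have h: "h > 0" using d1 d2 pos by (simp add: h_def)
  have close: "dist (x + s *\<^sub>R u + t *\<^sub>R v) x < min d1 d2" if "0 < s" "s < h" "0 < t" "t < h" for s t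
  proof -
    have "dist (x + s *\<^sub>R u + t *\<^sub>R v) x \<le> s * norm u + t * norm v"
      using that norm_triangle_ineq[of "s *\<^sub>R u" "t *\<^sub>R v"] by (simp add: dist_norm add.assoc)
    also have "\<dots> \<le> h * norm u + h * norm v"
      using that by (intro add_mono mult_right_mono) auto
    also have "\<dots> < h * (norm u + norm v + 1)" using h by (simp add: algebra_simps)
    also have "\<dots> = min d1 d2" using pos by (simp add: h_def)
    finally show ?thesis .
  qed
  obtain s t where st: "0 < s" "s < h" "0 < t" "t < h" and
    1: "f (x + h *\<^sub>R u + h *\<^sub>R v) - f (x + h *\<^sub>R v) - (f (x + h *\<^sub>R u) - f x)
        = h * (h * fu' (x + s *\<^sub>R u + t *\<^sub>R v) v)"
    using square[OF h fu] by blast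
  obtain s' t' where st': "0 < s'" "s' < h" "0 < t'" "t' < h" and
    2: "f (x + h *\<^sub>R v + h *\<^sub>R u) - f (x + h *\<^sub>R u) - (f (x + h *\<^sub>R v) - f x)
        = h * (h * fv' (x + s' *\<^sub>R v + t' *\<^sub>R u) u)"
    using square[OF h fv] by blast
  have eq: "fu' (x + s *\<^sub>R u + t *\<^sub>R v) v = fv' (x + t' *\<^sub>R u + s' *\<^sub>R v) u"
    using 1 2 h by (simp add: algebra_simps)
  have "dist (fu' (x + s *\<^sub>R u + t *\<^sub>R v) v) (fu' x v) < e"
    using close[OF st] by (intro d1) simp
  moreover have "dist (fv' (x + t' *\<^sub>R u + s' *\<^sub>R v) u) (fv' x u) < e"
    using close[OF st'(3,4,1,2)] by (intro d2) simp
  ultimately show False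
    unfolding eq e_def by (metis dist_commute dist_triangle_half_r less_irrefl)
qed

section \<open>Smooth functions\<close>

lemma ck_Suc_has_derivative:
  "ck (Suc k) f \<Longrightarrow> (f has_derivative frechet_derivative f (at x)) (at x)"
  by (simp add: frechet_derivative_works[symmetric])

lemma ck_Suc_imp_ck: "ck (Suc k) f \<Longrightarrow> ck k f"
proof (induction k arbitrary: f)
  case 0
  then show ?case
    by (auto intro!: continuous_at_imp_continuous_on differentiable_imp_continuous_within)
qed simp

lemma ck_const: "ck k (\<lambda>x. c)"
  by (induction k arbitrary: c) auto

lemma ck_add: "ck k f \<Longrightarrow> ck k g \<Longrightarrow> ck k (\<lambda>x. f x + g x)"
proof (induction k arbitrary: f g)
  case (Suc k)
  have "(\<lambda>x. frechet_derivative (\<lambda>x. f x + g x) (at x) v)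
      = (\<lambda>x. frechet_derivative f (at x) v + frechet_derivative g (at x) v)" for v
    by (intro ext frechet_derivative_at[OF has_derivative_add, symmetric, THEN fun_cong]
        ck_Suc_has_derivative[OF Suc.prems(1)] ck_Suc_has_derivative[OF Suc.prems(2)])
  then show ?case
    using Suc by (auto intro: differentiable_add)
qed (auto intro: continuous_on_add)

lemma ck_mult: "ck k f \<Longrightarrow> ck k g \<Longrightarrow> ck k (\<lambda>x. f x * g x)"
proof (induction k arbitrary: f g)
  case (Suc k)
  have "(\<lambda>x. frechet_derivative (\<lambda>x. f x * g x) (at x) v)
      = (\<lambda>x. f x * frechet_derivative g (at x) v + frechet_derivative f (at x) v * g x)" for v
    by (intro ext frechet_derivative_at[OF has_derivative_mult, symmetric, THEN fun_cong]
        ck_Suc_has_derivative[OF Suc.prems(1)] ck_Suc_has_derivative[OF Suc.prems(2)])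
  moreover have "ck k (\<lambda>x. f x * frechet_derivative g (at x) v
      + frechet_derivative f (at x) v * g x)" for v
    using Suc.prems ck_Suc_imp_ck by (intro ck_add Suc.IH) auto
  ultimately show ?case
    using Suc.prems by (auto intro: differentiable_mult)
qed (auto intro: continuous_on_mult)

lemma ck_nth: "ck k (\<lambda>x::real^'n::finite. x $ i)"
proof (cases k)
  case 0
  then show ?thesis by (auto intro: continuous_intros)
next
  case (Suc k')
  have "((\<lambda>x::real^'n. x $ i) has_derivative (\<lambda>x. x $ i)) (at x)" for x
    by (rule bounded_linear_imp_has_derivative) (rule bounded_linear_vec_nth)
  note d = this
  show ?thesis
    unfolding Suc using d frechet_derivative_at[OF d, symmetric]
    by (auto simp: ck_const differentiable_def)
qed

named_theorems smooth_intros

lemma smooth_const [smooth_intros]: "smooth (\<lambda>x. c)"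
  and smooth_nth [smooth_intros]: "smooth (\<lambda>x. x $ i)"
  and smooth_add [smooth_intros]: "smooth f \<Longrightarrow> smooth g \<Longrightarrow> smooth (\<lambda>x. f x + g x)"
  and smooth_mult [smooth_intros]: "smooth f \<Longrightarrow> smooth g \<Longrightarrow> smooth (\<lambda>x. f x * g x)"
  by (simp_all add: smooth_def ck_const ck_nth ck_add ck_mult)

lemma smooth_minus [smooth_intros]: "smooth f \<Longrightarrow> smooth (\<lambda>x. - f x)"
  using smooth_mult[OF smooth_const[of "-1"]] by simp

lemma smooth_diff [smooth_intros]: "smooth f \<Longrightarrow> smooth g \<Longrightarrow> smooth (\<lambda>x. f x - g x)"
  using smooth_add[OF _ smooth_minus] by simp

lemma smooth_divide_const [smooth_intros]: "smooth f \<Longrightarrow> smooth (\<lambda>x. f x / c)"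
  using smooth_mult[OF _ smooth_const[of "inverse c"]] by (simp add: field_simps)

lemma smooth_power [smooth_intros]: "smooth f \<Longrightarrow> smooth (\<lambda>x. f x ^ n)"
  by (induction n) (auto intro: smooth_intros)

lemma smooth_has_derivative:
  assumes "smooth f"
  shows "(f has_derivative frechet_derivative f (at x)) (at x)"
  using assms unfolding smooth_def by (metis ck.simps(2) frechet_derivative_works)

lemma smooth_frechet_derivative:
  assumes "smooth f"
  shows "smooth (\<lambda>x. frechet_derivative f (at x) v)"
  using assms unfolding smooth_def by (metis ck.simps(2))

lemma smooth_isCont:
  assumes "smooth f"
  shows "isCont f x"
  using has_derivative_continuous[OF smooth_has_derivative[OF assms]] .

lemma smooth_second_derivative_symmetric:
  fixes f :: "real^'n::finite \<Rightarrow> real"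
  assumes "smooth f"
  shows "frechet_derivative (\<lambda>y. frechet_derivative f (at y) u) (at x) v
       = frechet_derivative (\<lambda>y. frechet_derivative f (at y) v) (at x) u"
  by (rule mixed_second_derivatives_commute[where f = f and f' = "\<lambda>y. frechet_derivative f (at y)"])
    (intro smooth_has_derivative smooth_isCont smooth_frechet_derivative assms)+

section \<open>The bracket of vector fields in coordinates\<close>

lemma linear_axis_sum:
  fixes L :: "real^'n::finite \<Rightarrow> real"
  assumes "linear L"
  shows "L v = (\<Sum>i\<in>UNIV. v $ i * L (axis i 1))"
proof -
  have "L v = L (\<Sum>i\<in>UNIV. v $ i *\<^sub>R axis i 1)"
    using basis_expansion[of v] by (simp add: scalar_mult_eq_scaleR)
  then show ?thesis
    by (simp add: linear_sum[OF assms] linear_scale[OF assms])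
qed

text \<open>
  In \<open>V (W f) - W (V f)\<close> the second derivatives of \<open>f\<close> cancel by symmetry, and what remains is the
  derivative of \<open>f\<close> along \<open>Z\<close>. Applied to the coordinate functions, the defining condition of
  the bracket leaves no other choice.
\<close>
lemma lie_bracket_eqI:
  fixes V W Z :: "'n::finite vfield"
  assumes V: "\<And>x i. ((\<lambda>x. V x $ i) has_derivative V' x i) (at x)"
    and W: "\<And>x i. ((\<lambda>x. W x $ i) has_derivative W' x i) (at x)"
    and Z: "\<And>x i. Z x $ i = W' x i (V x) - V' x i (W x)"
  shows "lie_bracket V W = Z"
proof -
  let ?D = "\<lambda>f x. frechet_derivative f (at x)"
  have expand: "vfield_apply U f = (\<lambda>x. \<Sum>i\<in>UNIV. U x $ i * ?D f x (axis i 1))"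
    if "smooth f" for U :: "'n vfield" and f
    unfolding vfield_apply_def
    by (intro ext linear_axis_sum has_derivative_linear[OF smooth_has_derivative[OF that]])
  (* The product rule: the first sum will make up Z f, the second one is symmetric in U and T. *)
  have second: "vfield_apply U (vfield_apply T f) x
       = (\<Sum>i\<in>UNIV. T' x i (U x) * ?D f x (axis i 1))
        + (\<Sum>i\<in>UNIV. \<Sum>j\<in>UNIV. T x $ i * (U x $ j * ?D (\<lambda>y. ?D f y (axis i 1)) x (axis j 1)))"
    if f: "smooth f" and T: "\<And>x i. ((\<lambda>x. T x $ i) has_derivative T' x i) (at x)"
    for U T :: "'n vfield" and T' f x
  proof -
    let ?f = "\<lambda>i y. ?D f y (axis i 1)"
    have "((\<lambda>x. \<Sum>i\<in>UNIV. T x $ i * ?f i x) has_derivative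
        (\<lambda>h. \<Sum>i\<in>UNIV. T x $ i * ?D (?f i) x h + T' x i h * ?f i x)) (at x)"
      by (intro has_derivative_sum has_derivative_mult T smooth_has_derivative
          smooth_frechet_derivative f)
    from frechet_derivative_at[OF this, symmetric]
    have "vfield_apply U (vfield_apply T f) x
        = (\<Sum>i\<in>UNIV. T x $ i * ?D (?f i) x (U x) + T' x i (U x) * ?f i x)"
      unfolding expand[OF f] by (simp add: vfield_apply_def)
    moreover have "?D (?f i) x (U x) = (\<Sum>j\<in>UNIV. U x $ j * ?D (?f i) x (axis j 1))" for i
      by (intro linear_axis_sum has_derivative_linear[OF smooth_has_derivative]
          smooth_frechet_derivative f)
    ultimately show ?thesis
      by (simp add: sum.distrib sum_distrib_left)
  qed
  have Z_apply: "vfield_apply Z f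
      = vfield_apply V (vfield_apply W f) - vfield_apply W (vfield_apply V f)"
    if f: "smooth f" for f
  proof
    fix x
    have "(\<Sum>i\<in>UNIV. \<Sum>j\<in>UNIV. W x $ i * (V x $ j * ?D (\<lambda>y. ?D f y (axis i 1)) x (axis j 1)))
        = (\<Sum>i\<in>UNIV. \<Sum>j\<in>UNIV. V x $ i * (W x $ j * ?D (\<lambda>y. ?D f y (axis i 1)) x (axis j 1)))"
      by (subst sum.swap) (simp add: mult_ac smooth_second_derivative_symmetric[OF f])
    then show "vfield_apply Z f x
        = (vfield_apply V (vfield_apply W f) - vfield_apply W (vfield_apply V f)) x"
      unfolding minus_apply second[OF f W] second[OF f V]
      by (simp add: expand[OF f] Z left_diff_distrib sum_subtractf)
  qed
  have nth_apply: "vfield_apply U (\<lambda>x. x $ i) x = U x $ i" for U :: "'n vfield" and i x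
    using frechet_derivative_at[OF bounded_linear_imp_has_derivative[OF bounded_linear_vec_nth],
        of i x] by (metis vfield_apply_def)
  show ?thesis
    unfolding lie_bracket_def
  proof (rule the_equality)
    show "\<forall>f. smooth f \<longrightarrow> vfield_apply Z f
      = vfield_apply V (vfield_apply W f) - vfield_apply W (vfield_apply V f)"
      using Z_apply by blast
    fix U :: "'n vfield"
    assume "\<forall>f. smooth f \<longrightarrow> vfield_apply U f
      = vfield_apply V (vfield_apply W f) - vfield_apply W (vfield_apply V f)"
    then have "vfield_apply U (\<lambda>x. x $ i) = vfield_apply Z (\<lambda>x. x $ i)" for i
      by (simp add: Z_apply smooth_nth)
    then show "U = Z"
      by (intro ext) (metis nth_apply vec_eq_iff)
  qed
qed

section \<open>Coefficient vectors and structure constants\<close>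

lemma exhaust_8:
  fixes i :: 8
  shows "i = 1 \<or> i = 2 \<or> i = 3 \<or> i = 4 \<or> i = 5 \<or> i = 6 \<or> i = 7 \<or> i = 8"
proof (induct i)
  case (of_int z)
  then have "0 \<le> z" "z < 8" by simp_all
  then have "z = 0 \<or> z = 1 \<or> z = 2 \<or> z = 3 \<or> z = 4 \<or> z = 5 \<or> z = 6 \<or> z = 7" by arith
  then show ?case by auto
qed

lemma forall_8: "(\<forall>i::8. p i) \<longleftrightarrow> p 1 \<and> p 2 \<and> p 3 \<and> p 4 \<and> p 5 \<and> p 6 \<and> p 7 \<and> p 8"
  by (metis exhaust_8)

lemma UNIV_8: "UNIV = {1, 2, 3, 4, 5, 6, 7, 8::8}"
  using exhaust_8 by auto

definition vec8 :: "real \<Rightarrow> real \<Rightarrow> real \<Rightarrow> real \<Rightarrow> real \<Rightarrow> real \<Rightarrow> real \<Rightarrow> real \<Rightarrow> real^8" where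
  "vec8 a b c d e f g h = (\<chi> i. if i = 1 then a else if i = 2 then b else if i = 3 then c
     else if i = 4 then d else if i = 5 then e else if i = 6 then f else if i = 7 then g else h)"

lemma vec8_nth [simp]:
  "vec8 a b c d e f g h $ 1 = a" "vec8 a b c d e f g h $ 2 = b"
  "vec8 a b c d e f g h $ 3 = c" "vec8 a b c d e f g h $ 4 = d"
  "vec8 a b c d e f g h $ 5 = e" "vec8 a b c d e f g h $ 6 = f"
  "vec8 a b c d e f g h $ 7 = g" "vec8 a b c d e f g h $ 8 = h"
  by (simp_all add: vec8_def)

lemma axis_nth_8: "axis i (1::real) $ j = (if j = i then 1 else 0)" for i j :: 8
  by (simp add: axis_def)

lemma vec_eq_8: "a = b \<longleftrightarrow> a$1 = b$1 \<and> a$2 = b$2 \<and> a$3 = b$3 \<and> a$4 = b$4 \<and> a$5 = b$5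
    \<and> a$6 = b$6 \<and> a$7 = b$7 \<and> a$8 = b$8" for a b :: "'a^8"
  by (simp add: vec_eq_iff forall_8)

text \<open>
  The bracket of \<open>\<real>\<^sup>8\<close> with the structure constants of part (1): its only nonzero brackets of basis
  vectors are, up to antisymmetry, \<open>[1,2] = 3\<close>, \<open>[1,3] = 4\<close>, \<open>[2,3] = 5\<close>, \<open>[1,4] = 6\<close>,
  \<open>[1,5] = [2,4] = 7\<close> and \<open>[2,5] = 8\<close>.
\<close>
definition coord_bracket :: "real^8 \<Rightarrow> real^8 \<Rightarrow> real^8" where
  "coord_bracket a b = vec8 0 0 (a$1 * b$2 - a$2 * b$1)
     (a$1 * b$3 - a$3 * b$1) (a$2 * b$3 - a$3 * b$2)
     (a$1 * b$4 - a$4 * b$1)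
     (a$1 * b$5 - a$5 * b$1 + a$2 * b$4 - a$4 * b$2)
     (a$2 * b$5 - a$5 * b$2)"

lemma coord_bracket_simps:
  "coord_bracket (x + y) z = coord_bracket x z + coord_bracket y z"
  "coord_bracket z (x + y) = coord_bracket z x + coord_bracket z y"
  "coord_bracket (c *\<^sub>R x) y = c *\<^sub>R coord_bracket x y"
  "coord_bracket x (c *\<^sub>R y) = c *\<^sub>R coord_bracket x y"
  "coord_bracket x x = 0"
  "coord_bracket x (coord_bracket y z) +
     (coord_bracket y (coord_bracket z x) + coord_bracket z (coord_bracket x y)) = 0"
  by (simp_all add: coord_bracket_def vec_eq_8) (simp_all add: algebra_simps)

lemma real_lie_algebra_coord_bracket: "real_lie_algebra UNIV coord_bracket"
  by (simp add: real_lie_algebra_def coord_bracket_simps add.assoc)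

lemma real_lie_algebra_image:
  assumes V: "real_lie_algebra V br"
    and lin: "linear f"
    and hom: "\<And>x y. x \<in> V \<Longrightarrow> y \<in> V \<Longrightarrow> br' (f x) (f y) = f (br x y)"
  shows "real_lie_algebra (f ` V) br'"
proof -
  note V = V[unfolded real_lie_algebra_def]
  have sub: "subspace V"
    using V by blast
  have closed: "x + y \<in> V" "c *\<^sub>R x \<in> V" "br x y \<in> V" if "x \<in> V" "y \<in> V" for x y c
    using that V subspace_add[OF sub] subspace_scale[OF sub] by blast+
  have "f ` V = f ` span V"
    using sub by (metis span_eq_iff)
  then have "subspace (f ` V)"
    using linear_subspace_image[OF lin sub] by simp
  moreover have "br' (f x) (f y + f z) = br' (f x) (f y) + br' (f x) (f z)"
    "br' (f y + f z) (f x) = br' (f y) (f x) + br' (f z) (f x)"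
    "br' (c *\<^sub>R f x) (f y) = c *\<^sub>R br' (f x) (f y)"
    "br' (f x) (c *\<^sub>R f y) = c *\<^sub>R br' (f x) (f y)"
    "br' (f x) (f x) = 0"
    "br' (f x) (br' (f y) (f z)) + br' (f y) (br' (f z) (f x)) + br' (f z) (br' (f x) (f y)) = 0"
    if "x \<in> V" "y \<in> V" "z \<in> V" for x y z c
    using that V closed
    by (simp_all add: hom linear_0[OF lin]
        flip: linear_add[OF lin] linear_scale[OF lin])
  ultimately show ?thesis
    unfolding real_lie_algebra_def using hom closed by auto
qed

section \<open>The model fields\<close>

definition frame :: "real^8 \<Rightarrow> 8 vfield" where
  "frame a = a$1 *\<^sub>R X1 + a$2 *\<^sub>R X2 + a$3 *\<^sub>R X3 + a$4 *\<^sub>R X4 + a$5 *\<^sub>R X5 + a$6 *\<^sub>R X6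
     + a$7 *\<^sub>R X7 + a$8 *\<^sub>R X8"

lemmas X_defs = X1_def X2_def X3_def X4_def X5_def X6_def X7_def X8_def

lemma linear_frame: "linear frame"
  by (rule linearI) (simp_all add: frame_def algebra_simps)

lemma frame_nth:
  "frame a x $ 1 = a$1"
  "frame a x $ 2 = a$2"
  "frame a x $ 3 = a$3 - a$1 * x$2 / 2 + a$2 * x$1 / 2"
  "frame a x $ 4 = a$4 + a$2 * ((x$1)^2 + (x$2)^2) / 2 + a$3 * x$1"
  "frame a x $ 5 = a$5 - a$1 * ((x$1)^2 + (x$2)^2) / 2 + a$3 * x$2"
  "frame a x $ 6 = a$6 + a$2 * (x$1)^3 / 6 + a$3 * (x$1)^2 / 2 + a$4 * x$1"
  "frame a x $ 7 = a$7 - a$1 * x$1 * (x$2)^2 / 4 + a$2 * (x$1)^2 * x$2 / 4 + a$3 * x$1 * x$2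
     + a$4 * x$2 + a$5 * x$1"
  "frame a x $ 8 = a$8 - a$1 * (x$2)^3 / 6 + a$3 * (x$2)^2 / 2 + a$5 * x$2"
  by (simp_all add: frame_def scaleR_fun_def X_defs axis_nth_8)

text \<open>
  At the origin the eight fields are the coordinate vectors, so a field of constant coefficients is
  determined by its value there.
\<close>
lemma frame_at_0: "frame a 0 = a"
  by (simp add: vec_eq_8 frame_nth)

lemma frame_axis:
  "frame (axis 1 1) = X1" "frame (axis 2 1) = X2" "frame (axis 3 1) = X3" "frame (axis 4 1) = X4"
  "frame (axis 5 1) = X5" "frame (axis 6 1) = X6" "frame (axis 7 1) = X7" "frame (axis 8 1) = X8"
  by (simp_all add: frame_def axis_nth_8)

lemma range_frame: "range frame = span {X1, X2, X3, X4, X5, X6, X7, X8}"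
proof -
  have basis: "(Basis :: (real^8) set) = range (\<lambda>i. axis i 1)"
    by (auto simp: Basis_vec_def)
  have "frame ` Basis = {X1, X2, X3, X4, X5, X6, X7, X8}"
    unfolding basis UNIV_8 image_insert image_empty frame_axis ..
  then show ?thesis
    by (metis linear_span_image[OF linear_frame] span_Basis)
qed

definition frame_deriv :: "real^8 \<Rightarrow> real^8 \<Rightarrow> real^8 \<Rightarrow> real^8" where
  "frame_deriv a x w = vec8 0 0
     ((a$2 * w$1 - a$1 * w$2) / 2)
     (a$2 * (x$1 * w$1 + x$2 * w$2) + a$3 * w$1)
     (a$3 * w$2 - a$1 * (x$1 * w$1 + x$2 * w$2))
     (a$2 * (x$1)^2 * w$1 / 2 + a$3 * x$1 * w$1 + a$4 * w$1)
     (a$2 * (x$1 * x$2 * w$1 / 2 + (x$1)^2 * w$2 / 4) - a$1 * ((x$2)^2 * w$1 / 4 + x$1 * x$2 * w$2 / 2)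
       + a$3 * (x$1 * w$2 + x$2 * w$1) + a$4 * w$2 + a$5 * w$1)
     (a$3 * x$2 * w$2 + a$5 * w$2 - a$1 * (x$2)^2 * w$2 / 2)"

lemma has_derivative_nth [derivative_intros]:
  "((\<lambda>x. x $ i) has_derivative (\<lambda>h. h $ i)) (at x within S)" for x :: "real^'n::finite"
  by (rule bounded_linear_imp_has_derivative) (rule bounded_linear_vec_nth)

lemma frame_has_derivative:
  "((\<lambda>x. frame a x $ i) has_derivative (\<lambda>w. frame_deriv a x w $ i)) (at x)"
proof -
  have "\<forall>i. ((\<lambda>x. frame a x $ i) has_derivative (\<lambda>w. frame_deriv a x w $ i)) (at x)"
    unfolding forall_8 frame_nth frame_deriv_def vec8_nth
    by (intro conjI)
      (auto intro!: derivative_eq_intros simp: fun_eq_iff field_simps power2_eq_square power3_eq_cube)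
  then show ?thesis ..
qed

lemma smooth_frame: "smooth_vfield (frame a)"
  unfolding smooth_vfield_def forall_8 frame_nth by (intro conjI smooth_intros)

text \<open>
  This is the whole multiplication table of part (1), read off from the coordinate formula as one
  bilinear identity between polynomials.
\<close>
lemma lie_bracket_frame: "lie_bracket (frame a) (frame b) = frame (coord_bracket a b)"
proof (rule lie_bracket_eqI[OF frame_has_derivative frame_has_derivative])
  fix x i
  have "frame (coord_bracket a b) x = frame_deriv b x (frame a x) - frame_deriv a x (frame b x)"
    by (simp add: vec_eq_8 coord_bracket_def frame_deriv_def frame_nth)
      (simp add: field_simps power2_eq_square power3_eq_cube)
  then show "frame (coord_bracket a b) x $ i
      = frame_deriv b x (frame a x) $ i - frame_deriv a x (frame b x) $ i"
    by simp
qed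

lemma X0_nth:
  "X0 x $ 1 = x$2"
  "X0 x $ 2 = - x$1"
  "X0 x $ 3 = 0"
  "X0 x $ 4 = x$5"
  "X0 x $ 5 = - x$4"
  "X0 x $ 6 = P x"
  "X0 x $ 7 = Q x"
  "X0 x $ 8 = R x"
  by (simp_all add: X0_def axis_nth_8)

lemma smooth_X0: "smooth_vfield X0"
  unfolding smooth_vfield_def forall_8 X0_nth P_def Q_def R_def by (intro conjI smooth_intros)

definition X0_deriv :: "real^8 \<Rightarrow> real^8 \<Rightarrow> real^8" where
  "X0_deriv x w = vec8 (w$2) (- w$1) 0 (w$5) (- w$4)
     (x$1 * (x$2)^2 * w$1 / 4 + (x$1)^2 * x$2 * w$2 / 4 - (x$1)^3 * w$1 / 6 + w$7)
     ((x$2)^3 * w$1 / 12 + x$1 * (x$2)^2 * w$2 / 4 + (x$1)^2 * x$2 * w$1 / 4 + (x$1)^3 * w$2 / 12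
       - 2 * w$6 + 2 * w$8)
     (x$1 * (x$2)^2 * w$1 / 4 + (x$1)^2 * x$2 * w$2 / 4 - (x$2)^3 * w$2 / 6 - w$7)"

lemma X0_has_derivative:
  "((\<lambda>x. X0 x $ i) has_derivative (\<lambda>w. X0_deriv x w $ i)) (at x)"
proof -
  have "\<forall>i. ((\<lambda>x. X0 x $ i) has_derivative (\<lambda>w. X0_deriv x w $ i)) (at x)"
    unfolding forall_8 X0_nth X0_deriv_def vec8_nth P_def Q_def R_def
    by (intro conjI)
      (auto intro!: derivative_eq_intros simp: fun_eq_iff field_simps power2_eq_square power3_eq_cube)
  then show ?thesis ..
qed

text \<open>
  The derivation of \<open>coord_bracket\<close> that extends the infinitesimal rotation of the plane spanned by the
  generators; its matrix is the table of brackets \<open>[X\<^sub>0, X\<^sub>i]\<close> of part (2).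
\<close>
definition rot_gen :: "real^8 \<Rightarrow> real^8" where
  "rot_gen a = vec8 (- a$2) (a$1) 0 (- a$5) (a$4) (- a$7) (2 * a$6 - 2 * a$8) (a$7)"

lemma lie_bracket_X0_frame: "lie_bracket X0 (frame a) = frame (rot_gen a)"
proof (rule lie_bracket_eqI[OF X0_has_derivative frame_has_derivative])
  fix x i
  have "frame (rot_gen a) x = frame_deriv a x (X0 x) - X0_deriv x (frame a x)"
    by (simp add: vec_eq_8 rot_gen_def frame_deriv_def frame_nth X0_nth X0_deriv_def
        P_def Q_def R_def)
      (simp add: field_simps power2_eq_square power3_eq_cube power4_eq_xxxx)
  then show "frame (rot_gen a) x $ i = frame_deriv a x (X0 x) $ i - X0_deriv x (frame a x) $ i"
    by simp
qed

section \<open>Coordinates on the free nilpotent algebra\<close>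

text \<open>
  The homomorphism from the free algebra to \<open>(\<real>\<^sup>8, coord_bracket)\<close> that sends the generators to the
  first two basis vectors. It serves to show that the eight commutators below are linearly
  independent, also modulo commutators of high degree.
\<close>
primrec eval_expr :: "2 lie_expr \<Rightarrow> real^8" where
  "eval_expr (Gen g) = (if g = 1 then axis 1 1 else axis 2 1)"
| "eval_expr Zero = 0"
| "eval_expr (Add x y) = eval_expr x + eval_expr y"
| "eval_expr (Scale c x) = c *\<^sub>R eval_expr x"
| "eval_expr (Brk x y) = coord_bracket (eval_expr x) (eval_expr y)"

lemma eval_expr_respects: "lie_eq x y \<Longrightarrow> eval_expr x = eval_expr y"
  by (induction rule: lie_eq.induct) 
    (simp_all add: coord_bracket_simps add.assoc scaleR_add_right scaleR_add_left)

lift_definition free_eval :: "2 free_lie \<Rightarrow> real^8" is eval_expr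
  by (rule eval_expr_respects)

lemma linear_free_eval: "linear free_eval"
  by (rule linearI) (transfer; simp)+

lemma free_eval_bracket: "free_eval (free_bracket x y) = coord_bracket (free_eval x) (free_eval y)"
  by transfer simp

lemma free_eval_gen: "free_eval (free_gen 1) = axis 1 1" "free_eval (free_gen 2) = axis 2 1"
  by (transfer; simp)+

text \<open>
  The degree of the commutator that corresponds to the \<open>i\<close>-th basis vector.
\<close>
definition weight :: "8 \<Rightarrow> nat" where
  "weight i = (if i = 1 \<or> i = 2 then 1 else if i = 3 then 2 else if i = 4 \<or> i = 5 then 3 else 4)"

lemma weight_simps:
  "weight 1 = 1" "weight 2 = 1" "weight 3 = 2" "weight 4 = 3" "weight 5 = 3"
  "weight 6 = 4" "weight 7 = 4" "weight 8 = 4"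
  by (simp_all add: weight_def)

text \<open>
  The homomorphism respects degrees, since every structure constant adds weights: an entry of
  \<open>coord_bracket a b\<close> of weight \<open>k\<close> is built from products of entries whose weights add up to \<open>k\<close>.
\<close>
lemma free_eval_commutator:
  assumes "commutator n x"
  shows "\<forall>i. weight i \<noteq> n \<longrightarrow> free_eval x $ i = 0"
  using assms
proof induction
  case (gen a)
  then show ?case
    using exhaust_2[of a] by (auto simp: forall_8 weight_def free_eval_gen axis_nth_8)
next
  case (bracket m x n y)
  have "free_eval x $ i * free_eval y $ j = 0" "free_eval y $ j * free_eval x $ i = 0"
    if "weight i + weight j \<noteq> m + n" for i j
    using that bracket.IH by (metis mult_eq_0_iff)+
  note zero = this
  show ?case
    unfolding free_eval_bracket coord_bracket_def forall_8 vec8_nth weight_simps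
    by (simp add: zero weight_simps)
qed

lemma free_eval_high_commutators:
  assumes "x \<in> high_commutators TYPE(4)"
  shows "free_eval x = 0"
proof -
  have "weight i \<le> 4" for i
    by (simp add: weight_def)
  then have "free_eval x = 0" if "commutator n x" "n > 4" for n x
    using free_eval_commutator[OF that(1)] that(2) by (simp add: vec_eq_iff) (metis leD)
  then have "{x. \<exists>n>CARD(4). commutator n x} \<subseteq> {x. free_eval x = 0}"
    by auto
  then have "high_commutators TYPE(4) \<subseteq> {x. free_eval x = 0}"
    unfolding high_commutators_def
    by (intro span_minimal linear_subspace_kernel linear_free_eval)
  then show ?thesis
    using assms by blast
qed

text \<open>
  A Hall basis of the free algebra up to degree 4.
\<close>
definition E1 :: "2 free_lie" where "E1 = free_gen 1"
definition E2 :: "2 free_lie" where "E2 = free_gen 2"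
definition E3 :: "2 free_lie" where "E3 = free_bracket E1 E2"
definition E4 :: "2 free_lie" where "E4 = free_bracket E1 E3"
definition E5 :: "2 free_lie" where "E5 = free_bracket E2 E3"
definition E6 :: "2 free_lie" where "E6 = free_bracket E1 E4"
definition E7 :: "2 free_lie" where "E7 = free_bracket E1 E5"
definition E8 :: "2 free_lie" where "E8 = free_bracket E2 E5"

definition hall :: "real^8 \<Rightarrow> 2 free_lie" where
  "hall a = a$1 *\<^sub>R E1 + a$2 *\<^sub>R E2 + a$3 *\<^sub>R E3 + a$4 *\<^sub>R E4 + a$5 *\<^sub>R E5 + a$6 *\<^sub>R E6
     + a$7 *\<^sub>R E7 + a$8 *\<^sub>R E8"

lemma free_eval_hall: "free_eval (hall a) = a"
  by (simp add: hall_def linear_add[OF linear_free_eval] linear_scale[OF linear_free_eval]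
      E8_def E7_def E6_def E5_def E4_def E3_def E2_def E1_def free_eval_bracket free_eval_gen
      coord_bracket_def vec_eq_8 axis_nth_8)

lemma commutator_E:
  "commutator 1 E1" "commutator 1 E2" "commutator 2 E3" "commutator 3 E4" "commutator 3 E5"
  "commutator 4 E6" "commutator 4 E7" "commutator 4 E8"
proof -
  show 1: "commutator 1 E1" and 2: "commutator 1 E2"
    unfolding E1_def E2_def by (rule commutator.gen)+
  show 3: "commutator 2 E3"
    using commutator.bracket[OF 1 2] by (simp add: E3_def numeral_2_eq_2)
  show 4: "commutator 3 E4" and 5: "commutator 3 E5"
    using commutator.bracket[OF 1 3] commutator.bracket[OF 2 3]
    by (simp_all add: E4_def E5_def eval_nat_numeral)
  show "commutator 4 E6" "commutator 4 E7" "commutator 4 E8"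
    using commutator.bracket[OF 1 4] commutator.bracket[OF 1 5] commutator.bracket[OF 2 5]
    by (simp_all add: E6_def E7_def E8_def)
qed

definition nil_class :: "2 free_lie \<Rightarrow> (2, 4) free_nilpotent" where
  "nil_class = abs_free_nilpotent"

lemma linear_nil_class: "linear nil_class"
  by (rule linearI) (simp_all add: nil_class_def abs_free_nilpotent_simps)

lemma nil_class_bracket:
  "nil_class (free_bracket x y) = nilpotent_bracket (nil_class x) (nil_class y)"
  by (simp add: nil_class_def abs_free_nilpotent_simps)

lemma nil_class_eq_0_iff: "nil_class x = 0 \<longleftrightarrow> x \<in> high_commutators TYPE(4)"
proof -
  have "nil_class x = nil_class 0 \<longleftrightarrow> x - 0 \<in> high_commutators TYPE(4)"
    unfolding nil_class_def by (rule free_nilpotent.abs_eq_iff)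
  then show ?thesis
    by (simp add: linear_0[OF linear_nil_class])
qed

lemma nil_class_high_bracket:
  assumes "commutator m x" "commutator n y" "m + n > 4"
  shows "nil_class (free_bracket x y) = 0"
  using commutator.bracket[OF assms(1,2)] assms(3)
  by (auto simp: nil_class_eq_0_iff high_commutators_def intro!: span_base)

lemma free_bracket_antisym: "free_bracket x y = - free_bracket y x"
proof -
  have "0 = free_bracket (x + y) (x + y)"
    by (simp only: free_bracket_self)
  also have "\<dots> = free_bracket x y + free_bracket y x"
    unfolding free_bracket_add_left free_bracket_add_right by (simp add: free_bracket_self)
  finally show ?thesis
    by (metis eq_neg_iff_add_eq_0)
qed

text \<open>
  In the Jacobi identity for \<open>E1\<close>, \<open>E2\<close>, \<open>E3\<close> the term with \<open>[E1, E2]\<close> is \<open>[E3, E3] = 0\<close>.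
\<close>
lemma bracket_E2_E4: "free_bracket E2 E4 = E7"
proof -
  have "free_bracket E1 E5 + free_bracket E2 (- E4) + free_bracket E3 E3 = 0"
    using free_bracket_jacobi[of E1 E2 E3]
    unfolding E5_def E4_def free_bracket_antisym[of E3 E1] E3_def[symmetric] .
  moreover have "free_bracket E2 (- E4) = - free_bracket E2 E4"
    using free_bracket_scale_right[of E2 "-1" E4] by simp
  ultimately show ?thesis
    by (simp add: E7_def free_bracket_self)
qed

text \<open>
  Of the brackets of two basis elements, those of degree at most 4 are basis elements by definition
  or by the previous lemma, up to sign, and all others vanish in the quotient.
\<close>
lemma nil_class_hall_bracket:
  "nil_class (free_bracket (hall a) (hall b)) = nil_class (hall (coord_bracket a b))"
proof -
  have high: "nil_class (free_bracket x y) = 0 \<and> nil_class (free_bracket y x) = 0"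
    if "commutator m x" "commutator n y" "m + n > 4" for m n x y
    using that nil_class_high_bracket by (metis add.commute)
  note zero = commutator_E[THEN high, OF commutator_E(6), simplified]
    commutator_E[THEN high, OF commutator_E(7), simplified]
    commutator_E[THEN high, OF commutator_E(8), simplified]
    commutator_E(3-5)[THEN high, OF commutator_E(4), simplified]
    commutator_E(3-5)[THEN high, OF commutator_E(5), simplified]
  note E_brackets = E3_def[symmetric] E4_def[symmetric] E5_def[symmetric] E6_def[symmetric]
    E7_def[symmetric] E8_def[symmetric] bracket_E2_E4
    free_bracket_antisym[of E2 E1] free_bracket_antisym[of E3 E1] free_bracket_antisym[of E3 E2]
    free_bracket_antisym[of E4 E1] free_bracket_antisym[of E5 E1] free_bracket_antisym[of E4 E2]
    free_bracket_antisym[of E5 E2]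
  show ?thesis
    by (simp add: hall_def free_bracket_add_left free_bracket_add_right free_bracket_scale_left
        free_bracket_scale_right linear_add[OF linear_nil_class] linear_scale[OF linear_nil_class]
        linear_neg[OF linear_nil_class] linear_diff[OF linear_nil_class]
        E_brackets zero free_bracket_self coord_bracket_def linear_0[OF linear_nil_class])
      (simp add: algebra_simps)
qed

definition hall_class :: "real^8 \<Rightarrow> (2, 4) free_nilpotent" where
  "hall_class a = nil_class (hall a)"

lemma linear_hall: "linear hall"
  by (rule linearI) (simp_all add: hall_def algebra_simps)

lemma linear_hall_class: "linear hall_class"
  using linear_compose[OF linear_hall linear_nil_class] by (simp add: hall_class_def[abs_def] o_def)

lemma hall_class_bracket:
  "hall_class (coord_bracket a b) = nilpotent_bracket (hall_class a) (hall_class b)"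
  by (simp add: hall_class_def nil_class_hall_bracket flip: nil_class_bracket)

text \<open>
  One-to-one: if a combination lies in the ideal, then \<open>free_eval\<close> kills it, but \<open>free_eval\<close> returns
  its coefficients. Onto: the range is a subspace closed under brackets and contains the generators.
\<close>
lemma bij_hall_class: "bij hall_class"
proof (rule bijI)
  show "inj hall_class"
    unfolding linear_injective_0[OF linear_hall_class]
    by (metis free_eval_hall free_eval_high_commutators hall_class_def nil_class_eq_0_iff)
  have sub: "subspace (range hall_class)"
    by (intro linear_subspace_image linear_hall_class subspace_UNIV)
  have hc_gen: "hall_class (axis 1 1) = nil_class (free_gen 1)"
    "hall_class (axis 2 1) = nil_class (free_gen 2)"
    by (simp_all add: hall_class_def hall_def axis_nth_8 E1_def E2_def)
  have "nil_class (abs_free_lie e) \<in> range hall_class" for e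
  proof (induction e)
    case (Gen g)
    have "g = 1 \<or> g = 2" by (rule exhaust_2)
    then show ?case
      unfolding free_gen.abs_eq[symmetric] using hc_gen by (metis rangeI)
  next
    case Zero
    then show ?case
      by (metis zero_free_lie.abs_eq linear_0[OF linear_nil_class] subspace_0[OF sub])
  next
    case (Add x y)
    then show ?case
      by (metis plus_free_lie.abs_eq linear_add[OF linear_nil_class] subspace_add[OF sub])
  next
    case (Scale c x)
    then show ?case
      by (metis scaleR_free_lie.abs_eq linear_scale[OF linear_nil_class] subspace_scale[OF sub])
  next
    case (Brk x y)
    then show ?case
      unfolding free_bracket.abs_eq[symmetric] nil_class_bracket
      by (auto simp flip: hall_class_bracket)
  qed
  then have "nil_class x \<in> range hall_class" for x
    by (induction x rule: free_lie.abs_induct)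
  then have "y \<in> range hall_class" for y
    unfolding nil_class_def by (induction y rule: free_nilpotent.abs_induct)
  then show "surj hall_class"
    by blast
qed

text \<open>
  The isomorphism reads off the coefficients of a field as its value at the origin.
\<close>
lemma frame_lie_isomorphic:
  "lie_isomorphic (range frame) lie_bracket (UNIV :: (2, 4) free_nilpotent set) nilpotent_bracket"
proof -
  let ?h = "\<lambda>Z. hall_class (Z 0)"
  have "bij_betw (\<lambda>Z. Z 0) (range frame) UNIV"
    by (rule bij_betw_byWitness[where f' = frame]) (auto simp: frame_at_0)
  from bij_betw_trans[OF this bij_hall_class]
  have "bij_betw ?h (range frame) UNIV"
    by (simp add: o_def)
  moreover have "?h (lie_bracket (frame a) (frame b))
      = nilpotent_bracket (?h (frame a)) (?h (frame b))" for a b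
    by (simp add: lie_bracket_frame frame_at_0 hall_class_bracket)
  ultimately show ?thesis
    unfolding lie_isomorphic_def
    by (intro exI[of _ ?h])
      (auto simp: scaleR_fun_def linear_add[OF linear_hall_class] linear_scale[OF linear_hall_class])
qed

section \<open>The flow of the field X0\<close>

text \<open>
  Coordinates in which \<open>X0\<close> is linear: the quartics \<open>u\<^sub>6, u\<^sub>8\<close> that are added to \<open>x\<^sub>6, x\<^sub>8\<close> absorb
  the nonlinear parts \<open>p, q, r\<close> of \<open>P, Q, R\<close>. With \<open>D = x\<^sub>2 \<partial>/\<partial>x\<^sub>1 - x\<^sub>1 \<partial>/\<partial>x\<^sub>2\<close> this
  means \<open>D u\<^sub>6 = - p\<close>, \<open>2 (u\<^sub>8 - u\<^sub>6) = q\<close> and \<open>D u\<^sub>8 = - r\<close>.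
\<close>
definition chart :: "real^8 \<Rightarrow> real^8" where
  "chart x = x + vec8 0 0 0 0 0 (- ((x$1)^3 * x$2) / 24) 0 (x$1 * (x$2)^3 / 24)"

definition chart_inv :: "real^8 \<Rightarrow> real^8" where
  "chart_inv y = y - vec8 0 0 0 0 0 (- ((y$1)^3 * y$2) / 24) 0 (y$1 * (y$2)^3 / 24)"

definition chart_deriv :: "real^8 \<Rightarrow> real^8 \<Rightarrow> real^8" where
  "chart_deriv x w = w + vec8 0 0 0 0 0
     (- ((x$1)^2 * x$2 * w$1) / 8 - (x$1)^3 * w$2 / 24)
     0
     ((x$2)^3 * w$1 / 24 + x$1 * (x$2)^2 * w$2 / 8)"

lemma chart_inverse: "chart_inv (chart x) = x"
  by (simp add: chart_def chart_inv_def vec_eq_8)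

lemma has_derivative_vec_iff:
  fixes f :: "'a::real_normed_vector \<Rightarrow> real^'n::finite"
  shows "(f has_derivative f') (at x within S) \<longleftrightarrow>
    (\<forall>i. ((\<lambda>x. f x $ i) has_derivative (\<lambda>h. f' h $ i)) (at x within S))"
  unfolding has_derivative_componentwise_within[of f]
  by (simp add: Basis_vec_def inner_axis)

lemma chart_has_derivative: "(chart has_derivative chart_deriv x) (at x)"
  unfolding has_derivative_vec_iff forall_8 chart_def chart_deriv_def vector_add_component vec8_nth
  by (intro conjI)
    (auto intro!: derivative_eq_intros simp: fun_eq_iff field_simps power2_eq_square power3_eq_cube)

lemma chart_inv_has_derivative:
  "(chart_inv has_derivative (\<lambda>w. w - (chart_deriv x w - w))) (at x)"
  unfolding has_derivative_vec_iff forall_8 chart_inv_def chart_deriv_def vector_add_component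
    vector_minus_component vec8_nth
  by (intro conjI)
    (auto intro!: derivative_eq_intros simp: fun_eq_iff field_simps power2_eq_square power3_eq_cube)

text \<open>
  The flow of the linear field \<open>- rot_gen\<close>. Entries 1, 2 and entries 4, 5 rotate as a vector \<open>(\<alpha>, \<beta>)\<close>
  of the plane does, and entries 6, 7, 8 as its quadratic monomials \<open>\<alpha>\<^sup>2\<close>, \<open>2 \<alpha> \<beta>\<close>, \<open>\<beta>\<^sup>2\<close> do.
\<close>
definition rot :: "real \<Rightarrow> real^8 \<Rightarrow> real^8" where
  "rot t y = (let c = cos t; s = sin t in vec8
     (c * y$1 + s * y$2) (c * y$2 - s * y$1) (y$3) (c * y$4 + s * y$5) (c * y$5 - s * y$4)
     (c^2 * y$6 + c * s * y$7 + s^2 * y$8)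
     ((c^2 - s^2) * y$7 + 2 * c * s * (y$8 - y$6))
     (s^2 * y$6 - c * s * y$7 + c^2 * y$8))"

lemma linear_rot: "linear (rot t)"
  by (rule linearI) (simp_all add: rot_def Let_def vec_eq_8 algebra_simps)

lemma rot_0: "rot 0 y = y"
  by (simp add: rot_def vec_eq_8)

lemma rot_inverse: "rot t (rot (- t) y) = y"
proof -
  have trig: "cos t * cos t + sin t * sin t = 1"
    by (metis power2_eq_square sin_cos_squared_add2)
  show ?thesis
    unfolding vec_eq_8 rot_def Let_def vec8_nth cos_minus sin_minus
    by (intro conjI; (rule HOL.refl | (insert trig, algebra)))
qed

text \<open>
  Rotating back along a solution of \<open>y' = - rot_gen y\<close> gives a constant. This makes solutions
  unique without any estimate.
\<close>
lemma rot_deriv: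
  assumes "\<And>i. ((\<lambda>s. y s $ i) has_real_derivative - rot_gen (y t) $ i) (at t within S)"
  shows "((\<lambda>s. rot (- s) (y s) $ i) has_real_derivative 0) (at t within S)"
proof -
  note d = assms[of 1] assms[of 2] assms[of 3] assms[of 4] assms[of 5] assms[of 6] assms[of 7]
    assms[of 8]
  have "\<forall>i. ((\<lambda>s. rot (- s) (y s) $ i) has_real_derivative 0) (at t within S)"
    unfolding forall_8 rot_def Let_def vec8_nth cos_minus sin_minus
    using d unfolding rot_gen_def vec8_nth
    by (intro conjI)
      (auto intro!: derivative_eq_intros simp: algebra_simps power2_eq_square)
  then show ?thesis ..
qed

lemma chart_deriv_X0: "chart_deriv x (X0 x) = - rot_gen (chart x)"
  by (simp add: vec_eq_8 chart_deriv_def chart_def rot_gen_def X0_nth P_def Q_def R_def)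
    (simp add: field_simps power2_eq_square power3_eq_cube power4_eq_xxxx)

text \<open>
  The differential of the chart is the identity plus a map \<open>N\<close> with \<open>N\<^sup>2 = 0\<close>, because \<open>N w\<close> depends on
  \<open>w\<^sub>1, w\<^sub>2\<close> only and has no such entries. Its inverse is therefore the identity minus \<open>N\<close>.
\<close>
lemma chart_deriv_cancel: "chart_deriv x w - (chart_deriv x (chart_deriv x w) - chart_deriv x w) = w"
  by (simp add: vec_eq_8 chart_deriv_def)

text \<open>
  In the chart, the horizontal fields are equivariant under the rotations. Their entries depend on
  the first two coordinates only, so \<open>p\<close> needs to be the rotated point in these alone.
\<close>
lemma rot_frame_equivariant:
  fixes q p :: "real^8"
  assumes p: "p$1 = cos t * q$1 + sin t * q$2" "p$2 = cos t * q$2 - sin t * q$1"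
  shows "rot t (chart_deriv q (frame (vec8 a b 0 0 0 0 0 0) q))
       = chart_deriv p (frame (rot t (vec8 a b 0 0 0 0 0 0)) p)"
proof -
  have trig: "cos t * cos t + sin t * sin t = 1"
    by (metis power2_eq_square sin_cos_squared_add2)
  note unf = chart_deriv_def frame_nth rot_def Let_def vec8_nth vector_add_component p
  show ?thesis
    unfolding vec_eq_8
    (* Entries 1 and 2 are linear and agree literally; the others differ by a multiple of
       cos^2 + sin^2 - 1, so this relation enters only after the fractions are cleared. *)
    by (intro conjI; ((simp add: unf; fail) | (simp add: unf field_simps, insert trig, algebra)))
qed

definition flow :: "real \<Rightarrow> real^8 \<Rightarrow> real^8" where
  "flow t q = chart_inv (rot t (chart q))"

text \<open>
  In the chart, a trajectory of \<open>X0\<close> solves \<open>y' = - rot_gen y\<close>, so rotating it back by time \<open>t\<close> returns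
  its starting point. The time domain is an interval, which lets the zero derivative be integrated.
\<close>
lemma local_flow_X0_eq_flow:
  assumes flow: "local_flow X0 D \<phi>" and D: "(t, q) \<in> D"
  shows "\<phi> t q = flow t q"
proof -
  define T where "T = {s. (s, q) \<in> D}"
  have T: "0 \<in> T" "t \<in> T" "convex T" "\<phi> 0 q = q"
    using flow D by (auto simp: local_flow_def T_def is_interval_convex_1)
  have deriv: "((\<lambda>s. \<phi> s q) has_vector_derivative X0 (\<phi> s q)) (at s)" if "s \<in> T" for s
    using flow that by (auto simp: local_flow_def T_def)
  have chart': "((\<lambda>s. chart (\<phi> s q) $ i) has_real_derivative - rot_gen (chart (\<phi> s q)) $ i)
      (at s within T)" if "s \<in> T" for s i
  proof -
    have "((\<lambda>s. chart (\<phi> s q)) has_derivative (\<lambda>h. chart_deriv (\<phi> s q) (h *\<^sub>R X0 (\<phi> s q))))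
        (at s within T)"
      by (rule has_derivative_compose[OF _ chart_has_derivative])
        (use deriv[OF that] has_derivative_at_withinI in \<open>auto simp: has_vector_derivative_def\<close>)
    then have "((\<lambda>s. chart (\<phi> s q) $ i) has_derivative
        (\<lambda>h. chart_deriv (\<phi> s q) (h *\<^sub>R X0 (\<phi> s q)) $ i)) (at s within T)"
      by (simp add: has_derivative_vec_iff)
    moreover have "chart_deriv (\<phi> s q) (h *\<^sub>R X0 (\<phi> s q)) $ i
        = - rot_gen (chart (\<phi> s q)) $ i * h" for h
      using linear_scale[OF has_derivative_linear[OF chart_has_derivative], of "\<phi> s q" h "X0 (\<phi> s q)"]
      by (simp add: chart_deriv_X0)
    ultimately show ?thesis
      unfolding has_field_derivative_def by (simp only:)
  qed
  have "rot (- t) (chart (\<phi> t q)) $ i = rot (- 0) (chart (\<phi> 0 q)) $ i" for i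
  proof -
    have "((\<lambda>s. rot (- s) (chart (\<phi> s q)) $ i) has_vector_derivative 0) (at s within T)" if "s \<in> T" for s
      using rot_deriv[OF chart'[OF that]]
      by (simp add: has_real_derivative_iff_has_vector_derivative)
    from has_vector_derivative_zero_constant[OF T(3) this] show ?thesis
      using T(1,2) by metis
  qed
  then have "rot (- t) (chart (\<phi> t q)) = chart q"
    by (simp add: vec_eq_iff rot_0 T)
  then have "chart (\<phi> t q) = rot t (chart q)"
    by (metis rot_inverse)
  then show ?thesis
    by (metis flow_def chart_inverse)
qed

lemma rot_horizontal:
  "rot t (vec8 a b 0 0 0 0 0 0) = vec8 (cos t * a + sin t * b) (cos t * b - sin t * a) 0 0 0 0 0 0"
  by (simp add: rot_def Let_def)

lemma frame_horizontal: "frame (vec8 a b 0 0 0 0 0 0) x = a *\<^sub>R X1 x + b *\<^sub>R X2 x"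
  by (simp add: frame_def scaleR_fun_def)

text \<open>
  The differential of the flow is the conjugate of \<open>rot t\<close> by the differential of the chart, so
  equivariance in the chart says that it rotates the frame \<open>X1, X2\<close>.
\<close>
lemma flow_pushes_frame:
  obtains L where "(flow t has_derivative L) (at q)"
    "\<And>a b. L (a *\<^sub>R X1 q + b *\<^sub>R X2 q)
       = (cos t * a + sin t * b) *\<^sub>R X1 (flow t q) + (cos t * b - sin t * a) *\<^sub>R X2 (flow t q)"
proof
  let ?y = "rot t (chart q)"
  let ?C = "chart_deriv ?y"
  let ?L = "\<lambda>w. rot t (chart_deriv q w) - (?C (rot t (chart_deriv q w)) - rot t (chart_deriv q w))"
  have "(rot t has_derivative rot t) (at z)" for z
    by (rule linear_imp_has_derivative) (rule linear_rot)
  then have "((\<lambda>q. rot t (chart q)) has_derivative (\<lambda>w. rot t (chart_deriv q w))) (at q)"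
    by (rule has_derivative_compose[OF chart_has_derivative])
  from has_derivative_compose[OF this chart_inv_has_derivative]
  show "(flow t has_derivative ?L) (at q)"
    by (simp add: flow_def[abs_def])
  fix a b
  have "chart_deriv (flow t q) = ?C"
    by (simp add: fun_eq_iff chart_deriv_def flow_def chart_inv_def)
  moreover have "flow t q $ 1 = cos t * q$1 + sin t * q$2" "flow t q $ 2 = cos t * q$2 - sin t * q$1"
    by (simp_all add: flow_def chart_inv_def chart_def rot_def Let_def)
  ultimately have "?L (frame (vec8 a b 0 0 0 0 0 0) q)
      = frame (rot t (vec8 a b 0 0 0 0 0 0)) (flow t q)"
    by (simp add: rot_frame_equivariant[of "flow t q"] chart_deriv_cancel)
  then show "?L (a *\<^sub>R X1 q + b *\<^sub>R X2 q)
      = (cos t * a + sin t * b) *\<^sub>R X1 (flow t q) + (cos t * b - sin t * a) *\<^sub>R X2 (flow t q)"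
    by (simp only: rot_horizontal frame_horizontal)
qed

section \<open>The sub-Riemannian structure\<close>

lemma span_pair: "span {u, v} = {a *\<^sub>R u + b *\<^sub>R v |a b. True}"
  using span_Un[of "{u}" "{v}"] by (auto simp: span_singleton insert_commute)

lemma inner_product_on_orthonormal_pair:
  assumes "inner_product_on (span {u, v}) p"
    and "p u u = 1" "p u v = 0" "p v u = 0" "p v v = 1"
  shows "p (a *\<^sub>R u + b *\<^sub>R v) (c *\<^sub>R u + d *\<^sub>R v) = a * c + b * d"
proof -
  have S: "u \<in> span {u, v}" "v \<in> span {u, v}" "\<And>a. a *\<^sub>R u \<in> span {u, v}" "\<And>a. a *\<^sub>R v \<in> span {u, v}"
    "\<And>a b. a *\<^sub>R u + b *\<^sub>R v \<in> span {u, v}"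
    by (simp_all add: span_base span_scale span_add)
  have left: "p (a *\<^sub>R u + b *\<^sub>R v) w = a * p u w + b * p v w" if "w \<in> span {u, v}" for a b w
    using assms(1) S that unfolding inner_product_on_def by metis
  have sym: "p w z = p z w" if "w \<in> span {u, v}" "z \<in> span {u, v}" for w z
    using assms(1) that unfolding inner_product_on_def by metis
  show ?thesis
    by (simp add: left S sym[of u "c *\<^sub>R u + d *\<^sub>R v"] sym[of v "c *\<^sub>R u + d *\<^sub>R v"] assms(2-))
qed

lemma X_12: "X 1 = X1" "X (Suc 0) = X1" "X 2 = X2"
  by (simp_all add: X_def)

lemma X1_X2_nth: "X1 x $ 1 = 1" "X1 x $ 2 = 0" "X2 x $ 1 = 0" "X2 x $ 2 = 1"
  using frame_nth(1,2)[of "axis 1 1" x] frame_nth(1,2)[of "axis 2 1" x]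
  by (simp_all add: frame_axis axis_nth_8)

lemma orthonormal_frame_X1_X2_iff:
  "orthonormal_frame {1, 2} X \<Delta> g \<longleftrightarrow>
    (\<forall>q. \<Delta> q = span {X1 q, X2 q} \<and> inner_product_on (\<Delta> q) (g q) \<and>
      g q (X1 q) (X1 q) = 1 \<and> g q (X1 q) (X2 q) = 0 \<and>
      g q (X2 q) (X1 q) = 0 \<and> g q (X2 q) (X2 q) = 1)"
proof -
  have "{X i q |i. i \<in> {1, 2}} = (\<lambda>i. X i q) ` {1, 2}" for q
    by blast
  then have "{X i q |i. i \<in> {1, 2}} = {X1 q, X2 q}" for q
    by (simp only: image_insert image_empty X_12)
  moreover have "smooth_vfield X1" "smooth_vfield X2"
    using smooth_frame[of "axis 1 1"] smooth_frame[of "axis 2 1"] by (simp_all only: frame_axis)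
  ultimately show ?thesis
    unfolding orthonormal_frame_def by (simp only:) (simp add: X_12)
qed

text \<open>
  The first two entries of \<open>a X1 + b X2\<close> are \<open>a\<close> and \<open>b\<close>, so the Euclidean product of these entries is
  positive definite on the distribution and makes the frame orthonormal.
\<close>
lemma exists_orthonormal_frame: "\<exists>\<Delta> g. orthonormal_frame {1, 2} X \<Delta> g"
proof (intro exI)
  let ?g = "\<lambda>q u v. u$1 * v$1 + u$2 * v$2 :: real"
  have "inner_product_on (span {X1 q, X2 q}) (?g q)" for q
    unfolding inner_product_on_def span_pair
    by (auto simp: X1_X2_nth algebra_simps sum_power2_gt_zero_iff simp flip: power2_eq_square)
  then show "orthonormal_frame {1, 2} X (\<lambda>q. span {X1 q, X2 q}) ?g"
    unfolding orthonormal_frame_X1_X2_iff by (simp add: X1_X2_nth)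
qed

lemma infinitesimal_symmetry_X0:
  assumes "orthonormal_frame {1, 2} X \<Delta> g"
  shows "infinitesimal_symmetry X0 \<Delta> g"
proof -
  have \<Delta>: "\<Delta> q = span {X1 q, X2 q}"
    and g: "g q (a *\<^sub>R X1 q + b *\<^sub>R X2 q) (c *\<^sub>R X1 q + d *\<^sub>R X2 q) = a * c + b * d" for q a b c d
    using assms unfolding orthonormal_frame_X1_X2_iff
    by (metis, metis inner_product_on_orthonormal_pair)
  have isometry: "\<exists>L. (\<phi> t has_derivative L) (at q) \<and> L ` \<Delta> q = \<Delta> (\<phi> t q) \<and>
      (\<forall>u\<in>\<Delta> q. \<forall>v\<in>\<Delta> q. g (\<phi> t q) (L u) (L v) = g q u v)"
    if flow: "local_flow X0 D \<phi>" and D: "(t, q) \<in> D" for D \<phi> t q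
  proof -
    have \<phi>: "\<phi> t q' = flow t q'" if "(t, q') \<in> D" for q'
      using local_flow_X0_eq_flow[OF flow that] .
    obtain L where L: "(flow t has_derivative L) (at q)"
      and push: "\<And>a b. L (a *\<^sub>R X1 q + b *\<^sub>R X2 q)
       = (cos t * a + sin t * b) *\<^sub>R X1 (\<phi> t q) + (cos t * b - sin t * a) *\<^sub>R X2 (\<phi> t q)"
      using flow_pushes_frame[of t q] \<phi>[OF D] by metis
    have trig: "cos t * cos t + sin t * sin t = 1"
      by (metis power2_eq_square sin_cos_squared_add2)
    have "open (Pair t -` D)"
      using flow by (intro open_vimage) (auto simp: local_flow_def intro!: continuous_intros)
    then have "(\<phi> t has_derivative L) (at q)"
      by (rule has_derivative_transform_within_open[OF L]) (use D \<phi> in auto)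
    moreover have "L ` \<Delta> q = \<Delta> (\<phi> t q)"
    proof (intro equalityI subsetI)
      fix w
      assume "w \<in> L ` \<Delta> q"
      then show "w \<in> \<Delta> (\<phi> t q)"
        by (clarsimp simp: \<Delta> span_pair push) blast
    next
      fix w
      assume "w \<in> \<Delta> (\<phi> t q)"
      then obtain a b where w: "w = a *\<^sub>R X1 (\<phi> t q) + b *\<^sub>R X2 (\<phi> t q)"
        unfolding \<Delta> span_pair by blast
      (* The preimage is found by rotating the coefficients back by the angle t. *)
      have "cos t * (cos t * a - sin t * b) + sin t * (sin t * a + cos t * b) = a"
        "cos t * (sin t * a + cos t * b) - sin t * (cos t * a - sin t * b) = b"
        using trig by algebra+
      then have "w = L ((cos t * a - sin t * b) *\<^sub>R X1 q + (sin t * a + cos t * b) *\<^sub>R X2 q)"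
        by (simp only: push w)
      then show "w \<in> L ` \<Delta> q"
        by (auto simp: \<Delta> span_pair)
    qed
    moreover have "g (\<phi> t q) (L u) (L v) = g q u v" if mem: "u \<in> \<Delta> q" "v \<in> \<Delta> q" for u v
    proof -
      obtain a b c d where uv: "u = a *\<^sub>R X1 q + b *\<^sub>R X2 q" "v = c *\<^sub>R X1 q + d *\<^sub>R X2 q"
        using mem unfolding \<Delta> span_pair by blast
      show ?thesis
        unfolding uv push g using trig by algebra
    qed
    ultimately show ?thesis
      by blast
  qed
  then show ?thesis
    unfolding infinitesimal_symmetry_def using smooth_X0 by blast
qed

section \<open>The model of the free nilpotent Lie algebra and its symmetry\<close>

lemma X_eq_frame:
  "X 1 = frame (axis 1 1)" "X 2 = frame (axis 2 1)" "X 3 = frame (axis 3 1)"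
  "X 4 = frame (axis 4 1)" "X 5 = frame (axis 5 1)" "X 6 = frame (axis 6 1)"
  "X 7 = frame (axis 7 1)" "X 8 = frame (axis 8 1)"
  unfolding frame_axis by (simp_all add: X_def)

lemma lie_bracket_model_fields:
  "lie_bracket X1 X2 = X3" "lie_bracket X1 X3 = X4" "lie_bracket X2 X3 = X5"
  "lie_bracket X1 X4 = X6" "lie_bracket X1 X5 = X7" "lie_bracket X2 X4 = X7"
  "lie_bracket X2 X5 = X8"
  unfolding frame_axis[symmetric] lie_bracket_frame
  by (simp_all add: frame_def coord_bracket_def axis_nth_8)

lemma lie_bracket_X0_model_fields:
  "lie_bracket X0 X1 = X2" "lie_bracket X0 X2 = - X1" "lie_bracket X0 X3 = 0"
  "lie_bracket X0 X4 = X5" "lie_bracket X0 X5 = - X4" "lie_bracket X0 X6 = 2 *\<^sub>R X7"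
  "lie_bracket X0 X7 = X8 - X6" "lie_bracket X0 X8 = - (2 *\<^sub>R X7)"
  unfolding frame_axis[symmetric] lie_bracket_X0_frame
  by (simp_all add: frame_def rot_gen_def axis_nth_8)

lemma lie_bracket_model_fields_eq_0:
  assumes "1 \<le> i" "i < j" "j \<le> 8"
    and "(i, j) \<notin> {(1, 2), (1, 3), (2, 3), (1, 4), (1, 5), (2, 4), (2, 5)}"
  shows "lie_bracket (X i) (X j) = 0"
proof -
  have zero: "lie_bracket (frame (axis k 1)) (frame (axis l 1)) = 0"
    if "coord_bracket (axis k 1) (axis l 1) = 0" for k l
    by (simp add: lie_bracket_frame that linear_0[OF linear_frame])
  have "i = 1 \<or> i = 2 \<or> i = 3 \<or> i = 4 \<or> i = 5 \<or> i = 6 \<or> i = 7"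
    "j = 2 \<or> j = 3 \<or> j = 4 \<or> j = 5 \<or> j = 6 \<or> j = 7 \<or> j = 8"
    using assms(1-3) by arith+
  then show ?thesis
    using assms(2,4) unfolding One_nat_def[symmetric]
    by (elim disjE; hypsubst; (simp; fail)?; unfold X_eq_frame; intro zero)
      (simp_all add: coord_bracket_def vec_eq_8 axis_nth_8)
qed

theorem theorem2:
  shows
    "(lie_bracket X1 X2 = X3 \<and> lie_bracket X1 X3 = X4 \<and> lie_bracket X2 X3 = X5 \<and>
      lie_bracket X1 X4 = X6 \<and> lie_bracket X1 X5 = X7 \<and> lie_bracket X2 X4 = X7 \<and>
      lie_bracket X2 X5 = X8 \<and>
      (\<forall>i j. 1 \<le> i \<and> i < j \<and> j \<le> 8 \<and>
          (i, j) \<notin> {(1, 2), (1, 3), (2, 3), (1, 4), (1, 5), (2, 4), (2, 5)} \<longrightarrow>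
          lie_bracket (X i) (X j) = 0) \<and>
      real_lie_algebra (span {X1, X2, X3, X4, X5, X6, X7, X8}) lie_bracket \<and>
      lie_isomorphic (span {X1, X2, X3, X4, X5, X6, X7, X8}) lie_bracket
        (UNIV :: (2, 4) free_nilpotent set) nilpotent_bracket)
     \<and>
     (lie_bracket X0 X1 = X2 \<and> lie_bracket X0 X2 = - X1 \<and> lie_bracket X0 X3 = 0 \<and>
      lie_bracket X0 X4 = X5 \<and> lie_bracket X0 X5 = - X4 \<and>
      lie_bracket X0 X6 = 2 *\<^sub>R X7 \<and> lie_bracket X0 X7 = X8 - X6 \<and>
      lie_bracket X0 X8 = - (2 *\<^sub>R X7) \<and>
      (\<exists>\<Delta> g. orthonormal_frame {1, 2} X \<Delta> g) \<and>
      (\<forall>\<Delta> g. orthonormal_frame {1, 2} X \<Delta> g \<longrightarrow> infinitesimal_symmetry X0 \<Delta> g))"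
proof (intro conjI)
  have "real_lie_algebra (range frame) lie_bracket"
    by (rule real_lie_algebra_image[OF real_lie_algebra_coord_bracket linear_frame])
      (rule lie_bracket_frame)
  then show "real_lie_algebra (span {X1, X2, X3, X4, X5, X6, X7, X8}) lie_bracket"
    by (simp only: range_frame)
  show "lie_isomorphic (span {X1, X2, X3, X4, X5, X6, X7, X8}) lie_bracket
      (UNIV :: (2, 4) free_nilpotent set) nilpotent_bracket"
    using frame_lie_isomorphic by (simp only: range_frame)
qed (use lie_bracket_model_fields_eq_0 exists_orthonormal_frame infinitesimal_symmetry_X0 in
  \<open>blast intro: lie_bracket_model_fields lie_bracket_X0_model_fields\<close>)+

end
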